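(* Let $P_1,P_2\subset\mathbb{R}^d$ be finite sets with $|P_1|=m$, $|P_2|=n$ such that $P_1\cup P_2$ has diameter $1$, and let $G=(P_1,P_2,E)$ be the bipartite unit distance graph between them. If $G$ is $K_{u,u}$-free, then for every $\varepsilon>0$, writing $s=\lfloor (d+1)/2\rfloor$, \[|E|=O_{d,\varepsilon}\left(u^{\frac{2}{s+1}}(mn)^{\frac{s}{s+1}+\varepsilon}+u\,m^{1+\varepsilon}+u\,n^{1+\varepsilon}\right).\]
   Context: The bipartite unit distance graph between $P_1$ and $P_2$ has vertex classes $P_1,P_2$ and an edge $\{p_1,p_2\}$ ($p_1\in P_1$, $p_2\in P_2$) if and only if $\|p_1-p_2\|=1$. The diameter of a finite set is the maximum distance between two of its points. $K_{u,u}$-free means the graph contains no complete bipartite subgraph with $u$ vertices in each class. *)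

theory Defs
  imports "HOL-Analysis.Analysis"
begin

definition unit_dist_edges :: "'a::euclidean_space set \<Rightarrow> 'a set \<Rightarrow> ('a \<times> 'a) set" where
  "unit_dist_edges P1 P2 = {(p1, p2). p1 \<in> P1 \<and> p2 \<in> P2 \<and> dist p1 p2 = 1}"

definition Kuu_free :: "nat \<Rightarrow> 'a::euclidean_space set \<Rightarrow> 'a set \<Rightarrow> bool" where
  "Kuu_free u P1 P2 \<longleftrightarrow>
     \<not> (\<exists>A B. A \<subseteq> P1 \<and> B \<subseteq> P2 \<and> card A = u \<and> card B = u \<and> finite A \<and> finite B \<and>
              (\<forall>a\<in>A. \<forall>b\<in>B. dist a b = 1))"

end

theory Submission
  imports Defs "HOL-Computational_Algebra.Polynomial" "HOL-Real_Asymp.Real_Asymp"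
begin

text \<open>Lifting \<open>p\<close> to \<open>(p, p \<bullet> p)\<close> turns every point of \<open>P2\<close> into a halfspace that contains all lifted points of
  \<open>P1\<close>, with unit distances on its boundary. So only a single cell of the arrangement of hyperplanes matters, a
  polyhedron in dimension \<open>d + 1\<close>, and a random sample of the halfspaces cuts it into roughly \<open>r powr s\<close>
  simplices whose vertices violate few halfspaces each, since a polytope with \<open>n\<close> facets in dimension \<open>d + 1\<close>
  has \<open>O(n ^ ((d + 1) div 2))\<close> vertices. A halfspace that contains a simplex is tight at a point inside it
  if and only if it is tight at all vertices spanning the smallest face around the point. Hence the
  unit distances to such halfspaces form a complete bipartite graph, which is small as \<open>K_{u,u}\<close> is excluded.
  The violated halfspaces are handled by induction, where the roles of \<open>P1\<close> and \<open>P2\<close> are interchangeable.\<close>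

section \<open>Polytopes in general position\<close>

text \<open>The vertex count behind the cutting needs general position, but the lifted constraints
  may be degenerate: many of them can be tight at one point. The right-hand sides are therefore
  loosened slightly, the perturbed polytope is cut, and the limit of the simplices is taken.
  Loosening keeps the lifted points feasible, and violating a constraint is an open condition, so
  the conflict counts survive the limit. The exponent s / (s + 1) is the fixed point of one step:
  with r^s cells that partition the points while the halfspaces drop by a factor r, concavity of t^a
  gives the factor r^(s (1 - a) - a), which is 1 for a = s / (s + 1). Constants and a sample
  somewhat larger than r are paid out of (m n)^\<epsilon>. The term linear in the number of
  halfspaces grows by about r^(s - 1); it is dominated when the smaller class supplies the
  halfspaces and has at least r^(s + 1) u elements. Below that size the trivial bound m n is good
  enough.\<close>

definition polyhedron_of :: "'i set \<Rightarrow> ('i \<Rightarrow> 'e::euclidean_space) \<Rightarrow> ('i \<Rightarrow> real) \<Rightarrow> 'e set" where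
  "polyhedron_of S g \<beta> = {x. \<forall>i\<in>S. g i \<bullet> x \<le> \<beta> i}"

definition active :: "'i set \<Rightarrow> ('i \<Rightarrow> 'e::euclidean_space) \<Rightarrow> ('i \<Rightarrow> real) \<Rightarrow> 'e \<Rightarrow> 'i set" where
  "active S g \<beta> x = {i\<in>S. g i \<bullet> x = \<beta> i}"

text \<open>Injectivity makes two indices with the same normal dependent; the image set alone would
  hide the repetition.\<close>

definition indep_family :: "('i \<Rightarrow> 'e::euclidean_space) \<Rightarrow> 'i set \<Rightarrow> bool" where
  "indep_family g T \<longleftrightarrow> inj_on g T \<and> independent (g ` T)"

text \<open>The condition ranges over all points, feasible or not, so that it passes to every
  subsystem, in particular to a sample whose polyhedron is larger.\<close>

definition general_position :: "'i set \<Rightarrow> ('i \<Rightarrow> 'e::euclidean_space) \<Rightarrow> ('i \<Rightarrow> real) \<Rightarrow> bool" where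
  "general_position S g \<beta> \<longleftrightarrow> (\<forall>x. indep_family g (active S g \<beta> x))"

text \<open>Genericity makes every coefficient of \<open>c\<close> in the basis of normals active at
  a vertex nonzero, and it forces the minimum of \<open>c\<close> over a nonempty face of a polytope
  in general position to be attained at a vertex.\<close>

definition generic_objective :: "'i set \<Rightarrow> ('i \<Rightarrow> 'e::euclidean_space) \<Rightarrow> 'e \<Rightarrow> bool" where
  "generic_objective S g c \<longleftrightarrow> (\<forall>T\<subseteq>S. card T < DIM('e) \<longrightarrow> c \<notin> span (g ` T))"

lemma indep_family_subset: "indep_family g T \<Longrightarrow> T' \<subseteq> T \<Longrightarrow> indep_family g T'"
  unfolding indep_family_def by (meson image_mono independent_mono inj_on_subset)

lemma general_position_subset:
  assumes "general_position S g \<beta>" "S' \<subseteq> S"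
  shows "general_position S' g \<beta>"
proof -
  have "active S' g \<beta> x \<subseteq> active S g \<beta> x" for x
    using assms(2) by (auto simp: active_def)
  then show ?thesis
    using assms(1) indep_family_subset unfolding general_position_def by blast
qed

lemma indep_family_span_UNIV:
  fixes g :: "'i \<Rightarrow> 'e::euclidean_space"
  assumes "indep_family g T" "card T = DIM('e)"
  shows "span (g ` T) = UNIV"
proof -
  have "dim (g ` T) = DIM('e)"
    using assms unfolding indep_family_def by (simp add: card_image dim_eq_card_independent)
  then show ?thesis using dim_eq_full by blast
qed

lemma eq_if_active_spanning:
  fixes g :: "'i \<Rightarrow> 'e::euclidean_space"
  assumes "span (g ` T) = UNIV" "\<And>i. i \<in> T \<Longrightarrow> g i \<bullet> v = g i \<bullet> w"
  shows "v = w"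
proof -
  have "orthogonal (v - w) y" if "y \<in> span (g ` T)" for y
    using that
    by (rule orthogonal_to_span)
       (use assms(2) in \<open>auto simp: orthogonal_def inner_diff_left inner_diff_right inner_commute\<close>)
  then have "orthogonal (v - w) (v - w)" using assms(1) by blast
  then show ?thesis by (simp add: orthogonal_self)
qed

text \<open>Finitely many proper subspaces are null sets and cannot cover the space.\<close>

lemma exists_generic_objective:
  fixes g :: "'i \<Rightarrow> 'e::euclidean_space"
  assumes "finite S"
  shows "\<exists>c. generic_objective S g c"
proof -
  let ?\<T> = "{T. T \<subseteq> S \<and> card T < DIM('e)}"
  have fin: "finite ?\<T>" using assms by simp
  have "negligible (span (g ` T))" if "T \<in> ?\<T>" for T
  proof (rule negligible_lowdim)
    have "finite T" using that assms finite_subset by blast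
    then have "dim (g ` T) \<le> card T"
      by (meson card_image_le dim_le_card' finite_imageI le_trans)
    then show "dim (span (g ` T)) < DIM('e)" using that by simp
  qed
  then have "negligible (\<Union>T\<in>?\<T>. span (g ` T))"
    using fin by (intro negligible_Union) auto
  then have "(\<Union>T\<in>?\<T>. span (g ` T)) \<noteq> UNIV"
    using non_negligible_UNIV by metis
  then obtain c where "c \<notin> (\<Union>T\<in>?\<T>. span (g ` T))" by blast
  then show ?thesis unfolding generic_objective_def by blast
qed

lemma card_small_subsets:
  assumes "finite S"
  shows "card {J. J \<subseteq> S \<and> card J \<le> k} \<le> (k + 1) * (card S + 1) ^ k"
proof -
  have "{J. J \<subseteq> S \<and> card J \<le> k} \<subseteq> set ` {xs. set xs \<subseteq> S \<and> length xs \<le> k}"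
  proof
    fix J assume J: "J \<in> {J. J \<subseteq> S \<and> card J \<le> k}"
    then have "finite J" using assms finite_subset by auto
    then obtain xs where "set xs = J" "distinct xs" using finite_distinct_list by blast
    then show "J \<in> set ` {xs. set xs \<subseteq> S \<and> length xs \<le> k}"
      using J distinct_card[of xs] by force
  qed
  then have "card {J. J \<subseteq> S \<and> card J \<le> k} \<le> card {xs. set xs \<subseteq> S \<and> length xs \<le> k}"
    by (rule surj_card_le[OF finite_lists_length_le[OF assms]])
  also have "\<dots> = (\<Sum>i\<le>k. card S ^ i)" by (rule card_lists_length_le[OF assms])
  also have "\<dots> \<le> (\<Sum>i\<le>k. (card S + 1) ^ k)"
  proof (rule sum_mono)
    fix i assume "i \<in> {..k}"
    have "card S ^ i \<le> (card S + 1) ^ i" by (rule power_mono) auto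
    also have "\<dots> \<le> (card S + 1) ^ k" using \<open>i \<in> {..k}\<close> by (intro power_increasing) auto
    finally show "card S ^ i \<le> (card S + 1) ^ k" .
  qed
  finally show ?thesis by simp
qed

section \<open>Simple polytopes and the number of their vertices\<close>

locale generic_polytope =
  fixes S :: "'i set" and g :: "'i \<Rightarrow> 'e::euclidean_space" and \<beta> :: "'i \<Rightarrow> real" and c :: 'e
  assumes fin: "finite S"
    and gp: "general_position S g \<beta>"
    and gen: "generic_objective S g c"
    and bdd: "bounded (polyhedron_of S g \<beta>)"
begin

abbreviation "act \<equiv> active S g \<beta>"

definition vertices :: "'e set" where
  "vertices = {v \<in> polyhedron_of S g \<beta>. card (act v) = DIM('e)}"

definition face :: "'i set \<Rightarrow> 'e set" where
  "face J = {x \<in> polyhedron_of S g \<beta>. \<forall>j\<in>J. g j \<bullet> x = \<beta> j}"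

text \<open>The apex from which a face is coned off in the triangulation. The choice is meaningful
  only for a nonempty face, where compactness supplies a minimizer.\<close>

definition bottom :: "'i set \<Rightarrow> 'e" where
  "bottom J = (SOME v. v \<in> face J \<and> (\<forall>x\<in>face J. c \<bullet> v \<le> c \<bullet> x))"

lemma finite_act [simp]: "finite (act v)"
  using fin by (simp add: active_def)

lemma indep_act: "indep_family g (act v)"
  using gp by (simp add: general_position_def)

lemma span_act: "v \<in> vertices \<Longrightarrow> span (g ` act v) = UNIV"
  using indep_family_span_UNIV indep_act by (auto simp: vertices_def)

text \<open>If one coefficient vanished, \<open>c\<close> would lie in the span of
  \<open>DIM('e) - 1\<close> active normals, which genericity forbids.\<close>

lemma coefficients_exist:
  assumes "v \<in> vertices"
  shows "\<exists>l. c = (\<Sum>i\<in>act v. l i *\<^sub>R g i) \<and> (\<forall>i\<in>act v. l i \<noteq> 0)"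
proof -
  have inj: "inj_on g (act v)" using indep_act by (simp add: indep_family_def)
  have "c \<in> span (g ` act v)" using span_act[OF assms] by simp
  then obtain u where "c = (\<Sum>y\<in>g ` act v. u y *\<^sub>R y)"
    by (auto simp: span_finite)
  then have c: "c = (\<Sum>i\<in>act v. u (g i) *\<^sub>R g i)"
    by (simp add: sum.reindex[OF inj])
  have "u (g i) \<noteq> 0" if i: "i \<in> act v" for i
  proof
    assume "u (g i) = 0"
    then have "c = (\<Sum>k\<in>act v - {i}. u (g k) *\<^sub>R g k)"
      using c i by (simp add: sum.remove)
    also have "\<dots> \<in> span (g ` (act v - {i}))"
      by (intro span_sum span_scale span_base) auto
    finally have "c \<in> span (g ` (act v - {i}))" .
    moreover have "card (act v - {i}) < DIM('e)"
      using i assms by (simp add: vertices_def)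
    moreover have "act v - {i} \<subseteq> S" by (auto simp: active_def)
    ultimately show False using gen unfolding generic_objective_def by blast
  qed
  with c show ?thesis by (intro exI[of _ "\<lambda>i. u (g i)"]) simp
qed

definition coefficient :: "'e \<Rightarrow> 'i \<Rightarrow> real" where
  "coefficient v = (SOME l. c = (\<Sum>i\<in>act v. l i *\<^sub>R g i) \<and> (\<forall>i\<in>act v. l i \<noteq> 0))"

lemma coefficient:
  assumes "v \<in> vertices"
  shows "c = (\<Sum>i\<in>act v. coefficient v i *\<^sub>R g i)" "i \<in> act v \<Longrightarrow> coefficient v i \<noteq> 0"
  using someI_ex[OF coefficients_exist[OF assms]] unfolding coefficient_def by blast+

definition signed_part :: "real \<Rightarrow> 'e \<Rightarrow> 'i set" where
  "signed_part \<sigma> v = {i \<in> act v. \<sigma> * coefficient v i < 0}"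

text \<open>A vertex is the unique optimum of the objective \<open>c\<close> on the face cut out by the active constraints
  whose coefficient has the wrong sign.\<close>

lemma signed_part_terms:
  assumes "v \<in> vertices" "w \<in> vertices" "signed_part \<sigma> v = signed_part \<sigma> w" "i \<in> act v"
  shows "\<sigma> * coefficient v i * (g i \<bullet> w - \<beta> i) \<le> 0"
proof (cases "i \<in> signed_part \<sigma> v")
  case True
  then have "i \<in> signed_part \<sigma> w" using assms(3) by simp
  then show ?thesis by (auto simp: signed_part_def active_def)
next
  case False
  then have "\<sigma> * coefficient v i \<ge> 0" using assms(4) by (auto simp: signed_part_def)
  moreover have "g i \<bullet> w \<le> \<beta> i"
    using assms(2,4) by (auto simp: vertices_def active_def polyhedron_of_def)
  ultimately show ?thesis by (simp add: mult_nonneg_nonpos)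
qed

lemma objective_diff:
  assumes "v \<in> vertices"
  shows "\<sigma> * (c \<bullet> w - c \<bullet> v) = (\<Sum>i\<in>act v. \<sigma> * coefficient v i * (g i \<bullet> w - \<beta> i))"
proof -
  have "c \<bullet> w - c \<bullet> v = c \<bullet> (w - v)" by (simp add: inner_diff_right)
  also have "\<dots> = (\<Sum>i\<in>act v. coefficient v i *\<^sub>R g i) \<bullet> (w - v)"
    using coefficient(1)[OF assms] by simp
  also have "\<dots> = (\<Sum>i\<in>act v. coefficient v i * (g i \<bullet> w - g i \<bullet> v))"
    by (simp add: inner_sum_left inner_diff_right[of "g _"] flip: inner_diff_right[of "sum _ _"])
  also have "\<dots> = (\<Sum>i\<in>act v. coefficient v i * (g i \<bullet> w - \<beta> i))"
    by (rule sum.cong) (auto simp: active_def)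
  finally show ?thesis by (simp add: sum_distrib_left mult.assoc)
qed

text \<open>Each of two vertices with the same signed part is at least as good as the other for the
  objective \<sigma> c, so their values agree. A sum of nonpositive terms is then zero, every term
  vanishes, and since the coefficients are nonzero all constraints active at \<open>v\<close> are
  tight at \<open>w\<close>. They determine the point.\<close>

lemma inj_on_signed_part:
  assumes "\<sigma> \<noteq> 0"
  shows "inj_on (signed_part \<sigma>) vertices"
proof (rule inj_onI)
  fix v w assume vw: "v \<in> vertices" "w \<in> vertices" "signed_part \<sigma> v = signed_part \<sigma> w"
  have 1: "\<sigma> * (c \<bullet> w - c \<bullet> v) \<le> 0"
    unfolding objective_diff[OF vw(1)] by (rule sum_nonpos) (rule signed_part_terms[OF vw])
  have 2: "\<sigma> * (c \<bullet> v - c \<bullet> w) \<le> 0"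
    unfolding objective_diff[OF vw(2)]
    by (rule sum_nonpos) (rule signed_part_terms[OF vw(2,1) vw(3)[symmetric]])
  have "\<sigma> * (c \<bullet> w - c \<bullet> v) = 0" using 1 2 by (auto simp: right_diff_distrib simp del: mult_eq_0_iff)
  then have "(\<Sum>i\<in>act v. - (\<sigma> * coefficient v i * (g i \<bullet> w - \<beta> i))) = 0"
    unfolding objective_diff[OF vw(1)] by (simp add: sum_negf)
  then have "\<forall>i\<in>act v. - (\<sigma> * coefficient v i * (g i \<bullet> w - \<beta> i)) = 0"
    using signed_part_terms[OF vw] by (subst (asm) sum_nonneg_eq_0_iff) auto
  then have "g i \<bullet> w = \<beta> i" if "i \<in> act v" for i
    using that coefficient(2)[OF vw(1)] assms by auto
  then have "g i \<bullet> v = g i \<bullet> w" if "i \<in> act v" for i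
    using that by (auto simp: active_def)
  then show "v = w" using eq_if_active_spanning[OF span_act[OF vw(1)]] by blast
qed

lemma finite_vertices: "finite vertices"
  by (rule inj_on_finite[OF inj_on_signed_part[of 1], of "Pow S"])
     (use fin in \<open>auto simp: signed_part_def active_def\<close>)

text \<open>This is the upper bound theorem up to a constant. The signed parts for 1 and -1 split
  the \<open>DIM('e)\<close> active constraints of a vertex, so one of them has at most
  \<open>DIM('e) div 2\<close> elements, and either part determines the vertex.\<close>

lemma card_vertices_le:
  "card vertices \<le> 2 * ((DIM('e) div 2 + 1) * (card S + 1) ^ (DIM('e) div 2))"
proof -
  let ?k = "DIM('e) div 2"
  let ?V = "\<lambda>\<sigma>. {v \<in> vertices. card (signed_part \<sigma> v) \<le> ?k}"
  have "card (?V \<sigma>) \<le> card {J. J \<subseteq> S \<and> card J \<le> ?k}" if "\<sigma> \<noteq> 0" for \<sigma>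
    using inj_on_subset[OF inj_on_signed_part[OF that], of "?V \<sigma>"] fin
    by (intro card_inj_on_le[of "signed_part \<sigma>"]) (auto simp: signed_part_def active_def)
  then have V: "card (?V \<sigma>) \<le> (?k + 1) * (card S + 1) ^ ?k" if "\<sigma> \<noteq> 0" for \<sigma>
    using card_small_subsets[OF fin, of ?k] that le_trans by blast
  have "vertices \<subseteq> ?V 1 \<union> ?V (-1)"
  proof
    fix v assume v: "v \<in> vertices"
    have "card (signed_part 1 v) + card (signed_part (-1) v) = card (signed_part 1 v \<union> signed_part (-1) v)"
      by (rule card_Un_disjoint[symmetric]) (auto simp: signed_part_def)
    also have "signed_part 1 v \<union> signed_part (-1) v = act v"
    proof -
      have "coefficient v i < 0 \<or> coefficient v i > 0" if "i \<in> act v" for i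
        using coefficient(2)[OF v that] by linarith
      then show ?thesis by (auto simp: signed_part_def)
    qed
    finally have "card (signed_part 1 v) + card (signed_part (-1) v) = DIM('e)"
      using v by (simp add: vertices_def)
    then have "card (signed_part 1 v) \<le> ?k \<or> card (signed_part (-1) v) \<le> ?k" by linarith
    with v show "v \<in> ?V 1 \<union> ?V (-1)" by blast
  qed
  then have "card vertices \<le> card (?V 1 \<union> ?V (-1))"
    using finite_vertices by (intro card_mono) auto
  also have "\<dots> \<le> card (?V 1) + card (?V (-1))" by (rule card_Un_le)
  also have "\<dots> \<le> (?k + 1) * (card S + 1) ^ ?k + (?k + 1) * (card S + 1) ^ ?k"
    by (intro add_mono V) simp_all
  finally show ?thesis by (simp only: mult_2)
qed

section \<open>Triangulation of the polytope from the bottom vertices of its faces\<close>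

lemma compact_face: "compact (face J)"
proof -
  have "face J = polyhedron_of S g \<beta> \<inter> (\<Inter>j\<in>J. {x. g j \<bullet> x = \<beta> j})"
    by (auto simp: face_def)
  moreover have "polyhedron_of S g \<beta> = (\<Inter>i\<in>S. {x. g i \<bullet> x \<le> \<beta> i})"
    by (auto simp: polyhedron_of_def)
  ultimately have "closed (face J)"
    by (auto intro!: closed_Int closed_INT closed_hyperplane closed_halfspace_le)
  moreover have "bounded (face J)" using bdd by (rule bounded_subset) (auto simp: face_def)
  ultimately show ?thesis by (simp add: compact_eq_bounded_closed)
qed

lemma bottom:
  assumes "face J \<noteq> {}"
  shows "bottom J \<in> face J" "x \<in> face J \<Longrightarrow> c \<bullet> bottom J \<le> c \<bullet> x"
proof -
  have "\<exists>v. v \<in> face J \<and> (\<forall>x\<in>face J. c \<bullet> v \<le> c \<bullet> x)"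
    using continuous_attains_inf[OF compact_face assms
        continuous_on_inner[OF continuous_on_const continuous_on_id], of c] by blast
  from someI_ex[OF this]
  show "bottom J \<in> face J" "x \<in> face J \<Longrightarrow> c \<bullet> bottom J \<le> c \<bullet> x"
    unfolding bottom_def by blast+
qed

text \<open>Active constraints keep their value along \<open>w\<close>, and the finitely many others
  have slack.\<close>

lemma small_step_feasible:
  assumes "v \<in> polyhedron_of S g \<beta>" "\<And>i. i \<in> act v \<Longrightarrow> g i \<bullet> w = 0"
  shows "\<exists>t>0. v + t *\<^sub>R w \<in> polyhedron_of S g \<beta>"
proof -
  have "\<forall>\<^sub>F t in at_right 0. g i \<bullet> (v + t *\<^sub>R w) \<le> \<beta> i" if "i \<in> S" for i
  proof (cases "i \<in> act v")
    case True
    then show ?thesis using assms(2)[OF True] by (simp add: active_def inner_add_right)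
  next
    case False
    then have "g i \<bullet> v < \<beta> i" using that assms(1) by (force simp: active_def polyhedron_of_def)
    moreover have "((\<lambda>t. g i \<bullet> (v + t *\<^sub>R w)) \<longlongrightarrow> g i \<bullet> (v + 0 *\<^sub>R w)) (at_right 0)"
      by (intro tendsto_intros)
    ultimately have "\<forall>\<^sub>F t in at_right 0. g i \<bullet> (v + t *\<^sub>R w) < \<beta> i"
      by (intro order_tendstoD(2)) auto
    then show ?thesis by (rule eventually_mono) simp
  qed
  then have "\<forall>\<^sub>F t in at_right 0. \<forall>i\<in>S. g i \<bullet> (v + t *\<^sub>R w) \<le> \<beta> i"
    using fin by (simp add: eventually_ball_finite)
  moreover have "\<forall>\<^sub>F t::real in at_right 0. t > 0" by (rule eventually_at_right_less)
  ultimately have "\<forall>\<^sub>F t in at_right 0. t > 0 \<and> v + t *\<^sub>R w \<in> polyhedron_of S g \<beta>"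
    by eventually_elim (simp add: polyhedron_of_def)
  then show ?thesis using eventually_happens'[OF trivial_limit_at_right_real] by blast
qed

text \<open>With fewer than \<open>DIM('e)\<close> active constraints, \<open>c\<close> has a
  nonzero component \<open>z\<close> orthogonal to all active normals. A small step along
  \<open>- z\<close> stays in the face and lowers \<open>c\<close>, against minimality.\<close>

lemma bottom_in_vertices:
  assumes "J \<subseteq> S" "face J \<noteq> {}"
  shows "bottom J \<in> vertices"
proof -
  let ?v = "bottom J"
  have v: "?v \<in> face J" by (rule bottom(1)[OF assms(2)])
  then have vP: "?v \<in> polyhedron_of S g \<beta>" by (simp add: face_def)
  have inj: "inj_on g (act ?v)" and ind: "independent (g ` act ?v)"
    using indep_act by (auto simp: indep_family_def)
  have "card (act ?v) \<le> DIM('e)"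
    using independent_bound[OF ind] by (simp add: card_image[OF inj])
  moreover have "\<not> card (act ?v) < DIM('e)"
  proof
    assume "card (act ?v) < DIM('e)"
    then have cn: "c \<notin> span (g ` act ?v)"
      using gen unfolding generic_objective_def by (auto simp: active_def)
    obtain y z where yz: "y \<in> span (g ` act ?v)" "\<And>w. w \<in> span (g ` act ?v) \<Longrightarrow> orthogonal z w" "c = y + z"
      using orthogonal_subspace_decomp_exists[of "g ` act ?v" c] by metis
    have "z \<noteq> 0" using cn yz by auto
    have orth: "g i \<bullet> (- z) = 0" if "i \<in> act ?v" for i
      using yz(2)[of "g i"] that by (simp add: span_base orthogonal_def inner_commute)
    obtain t where t: "t > 0" "?v + t *\<^sub>R (- z) \<in> polyhedron_of S g \<beta>"
      using small_step_feasible[OF vP orth] by blast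
    have "J \<subseteq> act ?v" using v assms(1) by (auto simp: face_def active_def)
    then have "?v + t *\<^sub>R (- z) \<in> face J"
      using t(2) v orth by (auto simp: face_def inner_add_right inner_diff_right)
    then have "c \<bullet> ?v \<le> c \<bullet> (?v + t *\<^sub>R (- z))" by (rule bottom(2)[OF assms(2)])
    moreover have "c \<bullet> z = z \<bullet> z"
      using yz(2)[OF yz(1)] by (subst yz(3)) (simp add: inner_add_left orthogonal_def inner_commute[of z y])
    ultimately have "t * (z \<bullet> z) \<le> 0" by (simp add: inner_diff_right)
    moreover have "t * (z \<bullet> z) > 0" using \<open>z \<noteq> 0\<close> t(1) by simp
    ultimately show False by linarith
  qed
  ultimately show ?thesis using vP by (simp add: vertices_def)
qed

text \<open>The ratio test of the simplex method. Boundedness makes some constraint grow along the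
  ray, and \<open>j\<close> is the one that becomes tight first. Constraints in \<open>J\<close> are
  constant along the ray, so \<open>j\<close> is new; \<open>t\<close> is at least 1 because
  \<open>a\<close> is still feasible.\<close>

lemma exit_constraint:
  assumes v: "v \<in> face J" and a: "a \<in> face J" and "a \<noteq> v"
  shows "\<exists>j t. j \<in> S - J \<and> t \<ge> 1 \<and> v + t *\<^sub>R (a - v) \<in> face (insert j J)"
proof -
  define d where "d = a - v"
  have "d \<noteq> 0" using assms by (simp add: d_def)
  define H where "H = {i\<in>S. g i \<bullet> d > 0}"
  have "finite H" using fin by (simp add: H_def)
  have vi: "g i \<bullet> v \<le> \<beta> i" "g i \<bullet> a \<le> \<beta> i" if "i \<in> S" for i
    using v a that by (auto simp: face_def polyhedron_of_def)
  have "H \<noteq> {}"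
  proof
    assume "H = {}"
    obtain M where M: "\<And>x. x \<in> polyhedron_of S g \<beta> \<Longrightarrow> norm x \<le> M"
      using bdd bounded_iff by blast
    \<comment> \<open>The displacement \<open>t *\<^sub>R d\<close> gets norm
      \<open>M + norm v + 1\<close>, which carries the point out of the ball of radius
      \<open>M\<close>.\<close>
    define t where "t = (M + norm v + 1) / norm d"
    have "norm v \<le> M" using M v by (auto simp: face_def)
    then have "t \<ge> 0" unfolding t_def using norm_ge_zero[of v] by (intro divide_nonneg_nonneg norm_ge_zero) linarith
    have "g i \<bullet> (v + t *\<^sub>R d) \<le> \<beta> i" if "i \<in> S" for i
    proof -
      have "t * (g i \<bullet> d) \<le> 0"
        using \<open>H = {}\<close> that \<open>t \<ge> 0\<close> by (auto simp: H_def mult_le_0_iff not_less)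
      then show ?thesis using vi(1)[OF that] by (simp add: inner_add_right)
    qed
    then have "norm (v + t *\<^sub>R d) \<le> M" by (intro M) (auto simp: polyhedron_of_def)
    moreover have "norm (t *\<^sub>R d) \<le> norm (v + t *\<^sub>R d) + norm v"
      by (metis add_diff_cancel_left' norm_triangle_ineq4)
    moreover have "norm (t *\<^sub>R d) = M + norm v + 1"
      using \<open>norm v \<le> M\<close> \<open>d \<noteq> 0\<close> order_trans[OF norm_ge_zero \<open>norm v \<le> M\<close>] by (simp add: t_def)
    ultimately show False by linarith
  qed
  define \<theta> where "\<theta> i = (\<beta> i - g i \<bullet> v) / (g i \<bullet> d)" for i
  obtain j where j: "j \<in> H" "\<And>i. i \<in> H \<Longrightarrow> \<theta> j \<le> \<theta> i"
    using \<open>finite H\<close> \<open>H \<noteq> {}\<close> arg_min_if_finite[of H \<theta>] by (metis not_le)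
  have jS: "j \<in> S" "g j \<bullet> d > 0" using j by (auto simp: H_def)
  have "\<theta> j \<ge> 1"
    using vi(2)[OF jS(1)] jS(2) by (simp add: \<theta>_def d_def inner_diff_right)
  have jJ: "g i \<bullet> d = 0" if "i \<in> J" for i
    using v a that by (simp add: face_def d_def inner_diff_right)
  then have "j \<notin> J" using jS by force
  have "g i \<bullet> (v + \<theta> j *\<^sub>R d) \<le> \<beta> i" if "i \<in> S" for i
  proof (cases "i \<in> H")
    case True
    then have "\<theta> j * (g i \<bullet> d) \<le> \<theta> i * (g i \<bullet> d)"
      using j(2)[OF True] by (intro mult_right_mono) (auto simp: H_def)
    then show ?thesis using True by (simp add: \<theta>_def H_def inner_add_right)
  next
    case False
    then have "\<theta> j * (g i \<bullet> d) \<le> 0"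
      using \<open>\<theta> j \<ge> 1\<close> that by (auto simp: H_def mult_le_0_iff)
    then show ?thesis using vi(1)[OF that] by (simp add: inner_add_right)
  qed
  moreover have "g j \<bullet> (v + \<theta> j *\<^sub>R d) = \<beta> j"
    using jS by (simp add: \<theta>_def inner_add_right)
  moreover have "g i \<bullet> (v + \<theta> j *\<^sub>R d) = \<beta> i" if "i \<in> J" for i
    using v jJ[OF that] that by (simp add: face_def inner_add_right)
  ultimately have "v + \<theta> j *\<^sub>R d \<in> face (insert j J)"
    by (auto simp: face_def polyhedron_of_def)
  then show ?thesis using jS \<open>j \<notin> J\<close> \<open>\<theta> j \<ge> 1\<close> unfolding d_def by blast
qed

text \<open>Pulling triangulation: shoot a ray from the bottom vertex of the current face through the point
  until it leaves the face, and continue in the smaller face.\<close>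

lemma bottom_chain:
  assumes "J \<subseteq> S" "a \<in> face J"
  shows "\<exists>js. set js \<subseteq> S \<and> set js \<inter> J = {} \<and> distinct js \<and> face (J \<union> set js) \<noteq> {} \<and>
           a \<in> convex hull ((\<lambda>k. bottom (J \<union> set (take k js))) ` {..length js})"
  using assms
proof (induction "card (S - J)" arbitrary: J a rule: less_induct)
  case less
  let ?v = "bottom J"
  have ne: "face J \<noteq> {}" using less.prems by blast
  show ?case
  proof (cases "a = ?v")
    case True
    then show ?thesis using ne by (intro exI[of _ "[]"]) auto
  next
    case False
    obtain j t where jt: "j \<in> S - J" "t \<ge> 1" "?v + t *\<^sub>R (a - ?v) \<in> face (insert j J)"
      using exit_constraint[OF bottom(1)[OF ne] less.prems(2) False] by blast
    let ?a = "?v + t *\<^sub>R (a - ?v)"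
    have "card (S - insert j J) < card (S - J)"
      using jt(1) fin by (intro psubset_card_mono) auto
    then obtain js where js: "set js \<subseteq> S" "set js \<inter> insert j J = {}" "distinct js" "face (insert j J \<union> set js) \<noteq> {}"
        "?a \<in> convex hull ((\<lambda>k. bottom (insert j J \<union> set (take k js))) ` {..length js})"
      using less.hyps[OF _ _ jt(3)] less.prems(1) jt(1) by blast
    let ?X = "(\<lambda>k. bottom (insert j J \<union> set (take k js))) ` {..length js}"
    have img: "(\<lambda>k. bottom (J \<union> set (take k (j # js)))) ` {..length (j # js)} = insert ?v ?X"
      by (simp add: atMost_Suc_eq_insert_0 image_image)
    have "a = (1 - 1 / t) *\<^sub>R ?v + (1 / t) *\<^sub>R ?a"
      using jt(2) by (simp add: algebra_simps)
    moreover have "?v \<in> convex hull (insert ?v ?X)" by (simp add: hull_inc)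
    moreover have "?a \<in> convex hull (insert ?v ?X)"
      using js(5) hull_mono[of ?X "insert ?v ?X" convex] by blast
    ultimately have "a \<in> convex hull (insert ?v ?X)"
      using jt(2) convexD_alt[OF convex_convex_hull, of ?v "insert ?v ?X" ?a "1 / t"] by simp
    then show ?thesis
      using js jt(1) img by (intro exI[of _ "j # js"]) auto
  qed
qed

text \<open>A descent ends in a nonempty face, and every constraint collected on the way is active
  at the bottom vertex of that face. Hence a simplex is encoded by a vertex and a list of at most
  \<open>DIM('e)\<close> constraints active there, so the number of simplices is at most a constant,
  depending on the dimension, times the number of vertices.\<close>

lemma simplicial_cover:
  "\<exists>\<T>. finite \<T> \<and>
     card \<T> \<le> 2 * ((DIM('e) div 2 + 1) * (card S + 1) ^ (DIM('e) div 2)) * ((DIM('e) + 1) * (DIM('e) + 1) ^ DIM('e)) \<and>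
     (\<forall>T\<in>\<T>. T \<subseteq> vertices \<and> T \<noteq> {} \<and> card T \<le> DIM('e) + 1) \<and>
     (\<forall>a\<in>polyhedron_of S g \<beta>. \<exists>T\<in>\<T>. a \<in> convex hull T)"
proof -
  let ?D = "DIM('e)"
  define chain where "chain js = (\<lambda>k. bottom (set (take k js))) ` {..length js}" for js
  define L where "L v = {js. set js \<subseteq> act v \<and> length js \<le> ?D}" for v
  define \<T> where "\<T> = {T \<in> chain ` (\<Union>v\<in>vertices. L v). T \<subseteq> vertices \<and> card T \<le> ?D + 1}"
  have finL: "finite (L v)" for v
    unfolding L_def by (rule finite_lists_length_le) simp
  have fin: "finite (\<Union>v\<in>vertices. L v)" using finite_vertices finL by blast
  have cardL: "card (L v) \<le> (?D + 1) * (?D + 1) ^ ?D" if "v \<in> vertices" for v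
  proof -
    have "card (L v) = (\<Sum>i\<le>?D. ?D ^ i)"
      using that by (simp add: L_def card_lists_length_le vertices_def)
    also have "\<dots> \<le> (\<Sum>i\<le>?D. (?D + 1) ^ ?D)"
    proof (rule sum_mono)
      fix i assume "i \<in> {..?D}"
      have "?D ^ i \<le> (?D + 1) ^ i" by (rule power_mono) auto
      also have "\<dots> \<le> (?D + 1) ^ ?D" using \<open>i \<in> {..?D}\<close> by (intro power_increasing) auto
      finally show "?D ^ i \<le> (?D + 1) ^ ?D" .
    qed
    finally show ?thesis by simp
  qed
  have "card \<T> \<le> card (chain ` (\<Union>v\<in>vertices. L v))"
    unfolding \<T>_def using fin by (intro card_mono) auto
  also have "\<dots> \<le> card (\<Union>v\<in>vertices. L v)" by (rule card_image_le[OF fin])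
  also have "\<dots> \<le> (\<Sum>v\<in>vertices. card (L v))" by (rule card_UN_le[OF finite_vertices])
  also have "\<dots> \<le> card vertices * ((?D + 1) * (?D + 1) ^ ?D)"
    using sum_bounded_above[of vertices "\<lambda>v. card (L v)"] cardL by simp
  also have "\<dots> \<le> 2 * ((?D div 2 + 1) * (card S + 1) ^ (?D div 2)) * ((?D + 1) * (?D + 1) ^ ?D)"
    by (rule mult_right_mono[OF card_vertices_le]) simp
  finally have card: "card \<T> \<le> \<dots>" .
  have cover: "\<exists>T\<in>\<T>. a \<in> convex hull T" if "a \<in> polyhedron_of S g \<beta>" for a
  proof -
    have "a \<in> face {}" using that by (simp add: face_def)
    from bottom_chain[OF _ this] obtain js where js: "set js \<subseteq> S" "distinct js" "face (set js) \<noteq> {}"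
        "a \<in> convex hull (chain js)"
      by (auto simp: chain_def)
    let ?v = "bottom (set js)"
    have v: "?v \<in> vertices" by (rule bottom_in_vertices[OF js(1,3)])
    have sub: "set js \<subseteq> act ?v" using bottom(1)[OF js(3)] js(1) by (auto simp: face_def active_def)
    have "length js \<le> ?D"
      using card_mono[OF finite_act sub] v js(2) by (simp add: distinct_card vertices_def)
    moreover have "chain js \<subseteq> vertices"
    proof -
      have "bottom (set (take k js)) \<in> vertices" for k
      proof (rule bottom_in_vertices)
        show "set (take k js) \<subseteq> S" using js(1) set_take_subset by fast
        have "face (set js) \<subseteq> face (set (take k js))"
          using set_take_subset[of k js] by (auto simp: face_def)
        then show "face (set (take k js)) \<noteq> {}" using js(3) by blast
      qed
      then show ?thesis by (auto simp: chain_def)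
    qed
    moreover have "card (chain js) \<le> length js + 1"
      unfolding chain_def using card_image_le[of "{..length js}"] by simp
    moreover have "js \<in> (\<Union>v\<in>vertices. L v)"
      using v sub \<open>length js \<le> ?D\<close> unfolding L_def by blast
    ultimately have "chain js \<in> \<T>" unfolding \<T>_def by simp
    then show ?thesis using js(4) by blast
  qed
  show ?thesis
  proof (intro exI[of _ \<T>] conjI ballI)
    show "finite \<T>" unfolding \<T>_def using fin by simp
    fix T assume "T \<in> \<T>"
    then show "T \<subseteq> vertices" "card T \<le> ?D + 1" unfolding \<T>_def by blast+
    show "T \<noteq> {}" using \<open>T \<in> \<T>\<close> unfolding \<T>_def chain_def by blast
  qed (fact card, fact cover)
qed

end

section \<open>Cuttings of a family of halfspaces\<close>

text \<open>The probabilistic argument behind \<open>\<epsilon>\<close>-nets, as a count of sequences: a sequence in \<open>B\<close> is bad for a set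
  \<open>K\<close> of positions if the entries at \<open>K\<close> determine a large conflict set that all other entries avoid.\<close>

lemma sample_avoiding_large_conflicts:
  fixes B :: "'b set" and V :: "'b set \<Rightarrow> 'b set set" and r :: real
  assumes "finite B" "r \<ge> 1"
    and V: "\<And>Y. Y \<subseteq> B \<Longrightarrow> card Y \<le> k \<Longrightarrow> finite (V Y) \<and> card (V Y) \<le> M"
    and "B \<noteq> {}"
    and small: "real ((k + 1) * (\<rho> + 1) ^ k) * (real M * (1 - 1 / r) ^ (\<rho> - k)) < 1"
  shows "\<exists>R\<subseteq>B. card R \<le> \<rho> \<and>
           (\<forall>Y\<subseteq>R. card Y \<le> k \<longrightarrow> (\<forall>X\<in>V Y. X \<subseteq> B \<longrightarrow> X \<inter> R = {} \<longrightarrow> real (card X) \<le> card B / r))"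
proof -
  define n where "n = card B"
  have "n > 0" using assms by (simp add: n_def card_gt_0_iff)
  define q where "q = 1 - 1 / r"
  have q: "0 \<le> q" "q \<le> 1" using \<open>r \<ge> 1\<close> by (auto simp: q_def)
  \<comment> \<open>Sampling with replacement makes the entries independent, so that the sequences
    with prescribed behaviour at each position are counted by a product.\<close>
  define F where "F = PiE {..<\<rho>} (\<lambda>_. B)"
  have finF: "finite F" and cardF: "card F = n ^ \<rho>"
    using \<open>finite B\<close> by (auto simp: F_def card_PiE n_def intro: finite_PiE)
  define V' where "V' Y = {X \<in> V Y. X \<subseteq> B \<and> real (card X) > n / r}" for Y
  define bad where "bad K = {x \<in> F. \<exists>X\<in>V' (x ` K). X \<inter> x ` {..<\<rho>} = {}}" for K
  define \<K> where "\<K> = {K. K \<subseteq> {..<\<rho>} \<and> card K \<le> k}"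
  have fin\<K>: "finite \<K>" by (auto simp: \<K>_def)
  have card_bad: "real (card (bad K)) \<le> n ^ \<rho> * (M * q ^ (\<rho> - k))" if K: "K \<in> \<K>" for K
  proof -
    have K': "K \<subseteq> {..<\<rho>}" "card K \<le> k" "finite K" "card K \<le> \<rho>"
      using K card_mono[of "{..<\<rho>}" K] finite_subset[of K "{..<\<rho>}"] by (auto simp: \<K>_def)
    \<comment> \<open>A bad sequence is covered by a choice \<open>y\<close> of its entries at
      \<open>K\<close> and a large conflict set \<open>X\<close> determined by them. As
      \<open>X\<close> has more than \<open>n / r\<close> elements, each remaining position has at
      most \<open>n * q\<close> choices.\<close>
    define Q where "Q y X = PiE {..<\<rho>} (\<lambda>i. if i \<in> K then {y i} else B - X)" for y X
    let ?Y = "PiE K (\<lambda>_. B)"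
    have V'Y: "finite (V' (y ` K)) \<and> card (V' (y ` K)) \<le> M" if "y \<in> ?Y" for y
    proof -
      have "y ` K \<subseteq> B" using that by auto
      moreover have "card (y ` K) \<le> k" using card_image_le[OF K'(3)] K'(2) le_trans by blast
      ultimately have "finite (V (y ` K)) \<and> card (V (y ` K)) \<le> M" by (rule V)
      moreover have "V' (y ` K) \<subseteq> V (y ` K)" by (auto simp: V'_def)
      ultimately show ?thesis by (meson card_mono finite_subset le_trans)
    qed
    have finY: "finite ?Y" using K' \<open>finite B\<close> by (intro finite_PiE) auto
    have finQ: "finite (Q y X)" for y X
      using \<open>finite B\<close> by (auto simp: Q_def intro: finite_PiE)
    have "bad K \<subseteq> (\<Union>y\<in>?Y. \<Union>X\<in>V' (y ` K). Q y X)"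
    proof
      fix x assume "x \<in> bad K"
      then obtain X where x: "x \<in> F" and X: "X \<in> V' (x ` K)" "X \<inter> x ` {..<\<rho>} = {}"
        by (auto simp: bad_def)
      let ?y = "restrict x K"
      have "?y \<in> ?Y" using x K' by (auto simp: F_def)
      moreover have "X \<in> V' (?y ` K)" using X(1) by simp
      moreover have "x \<in> Q ?y X"
        unfolding Q_def
      proof (rule PiE_I)
        fix i assume "i \<in> {..<\<rho>}"
        then have "x i \<in> B" "x i \<notin> X" using x X(2) by (auto simp: F_def)
        then show "x i \<in> (if i \<in> K then {?y i} else B - X)" by simp
      next
        fix i assume "i \<notin> {..<\<rho>}"
        then show "x i = undefined" using x unfolding F_def by (rule PiE_arb[rotated])
      qed
      ultimately show "x \<in> (\<Union>y\<in>?Y. \<Union>X\<in>V' (y ` K). Q y X)" by blast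
    qed
    moreover have "finite (\<Union>y\<in>?Y. \<Union>X\<in>V' (y ` K). Q y X)"
      using finY V'Y finQ by blast
    ultimately have "card (bad K) \<le> card (\<Union>y\<in>?Y. \<Union>X\<in>V' (y ` K). Q y X)" by (intro card_mono)
    also have "\<dots> \<le> (\<Sum>y\<in>?Y. card (\<Union>X\<in>V' (y ` K). Q y X))" by (rule card_UN_le[OF finY])
    also have "\<dots> \<le> (\<Sum>y\<in>?Y. \<Sum>X\<in>V' (y ` K). card (Q y X))"
      using V'Y by (intro sum_mono card_UN_le) auto
    finally have "real (card (bad K)) \<le> real (\<Sum>y\<in>?Y. \<Sum>X\<in>V' (y ` K). card (Q y X))"
      using of_nat_mono by blast
    also have "\<dots> = (\<Sum>y\<in>?Y. \<Sum>X\<in>V' (y ` K). real (card (Q y X)))" by simp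
    also have "\<dots> \<le> (\<Sum>y\<in>?Y. real M * (n * q) ^ (\<rho> - card K))"
    proof (rule sum_mono)
      fix y assume y: "y \<in> ?Y"
      have "real (card (Q y X)) \<le> (n * q) ^ (\<rho> - card K)" if X: "X \<in> V' (y ` K)" for X
      proof -
        have XB: "X \<subseteq> B" "real (card X) > n / r" using X by (auto simp: V'_def)
        have "card (Q y X) = (\<Prod>i<\<rho>. if i \<in> K then 1 else card (B - X))"
          unfolding Q_def by (subst card_PiE) (auto intro: prod.cong)
        also have "\<dots> = card (B - X) ^ card ({..<\<rho>} - K)"
          by (simp add: prod.If_cases Diff_eq Int_commute)
        also have "card ({..<\<rho>} - K) = \<rho> - card K" using K' by (simp add: card_Diff_subset)
        finally have "real (card (Q y X)) = real (card (B - X)) ^ (\<rho> - card K)" by simp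
        also have "\<dots> \<le> (n * q) ^ (\<rho> - card K)"
        proof (rule power_mono)
          have "card (B - X) = n - card X" "card X \<le> n"
            using XB(1) \<open>finite B\<close> by (auto simp: n_def card_Diff_subset finite_subset card_mono)
          then show "real (card (B - X)) \<le> n * q"
            using XB(2) by (simp add: q_def of_nat_diff algebra_simps)
        qed simp
        finally show ?thesis .
      qed
      then have "(\<Sum>X\<in>V' (y ` K). real (card (Q y X))) \<le> card (V' (y ` K)) * (n * q) ^ (\<rho> - card K)"
        by (rule sum_bounded_above)
      also have "\<dots> \<le> real M * (n * q) ^ (\<rho> - card K)"
        using V'Y[OF y] q by (intro mult_right_mono) auto
      finally show "(\<Sum>X\<in>V' (y ` K). real (card (Q y X))) \<le> real M * (n * q) ^ (\<rho> - card K)" .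
    qed
    also have "\<dots> = n ^ card K * (M * (n * q) ^ (\<rho> - card K))"
      using K' by (simp add: card_PiE n_def)
    also have "\<dots> = n ^ (card K + (\<rho> - card K)) * (M * q ^ (\<rho> - card K))"
      by (simp add: power_add power_mult_distrib algebra_simps)
    also have "\<dots> = n ^ \<rho> * (M * q ^ (\<rho> - card K))" using K'(4) by simp
    also have "\<dots> \<le> n ^ \<rho> * (M * q ^ (\<rho> - k))"
      using K'(2) q by (intro mult_left_mono power_decreasing) auto
    finally show ?thesis .
  qed
  have "real (card (\<Union>K\<in>\<K>. bad K)) \<le> (\<Sum>K\<in>\<K>. real (card (bad K)))"
    using card_UN_le[OF fin\<K>, of bad] by (metis of_nat_le_iff of_nat_sum)
  also have "\<dots> \<le> card \<K> * (n ^ \<rho> * (M * q ^ (\<rho> - k)))"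
    using card_bad by (rule sum_bounded_above)
  also have "\<dots> \<le> ((k + 1) * (\<rho> + 1) ^ k) * (n ^ \<rho> * (M * q ^ (\<rho> - k)))"
    using card_small_subsets[of "{..<\<rho>}" k] q unfolding \<K>_def
    by (intro mult_right_mono of_nat_mono) auto
  also have "\<dots> = n ^ \<rho> * (((k + 1) * (\<rho> + 1) ^ k) * (M * q ^ (\<rho> - k)))" by (simp add: mult_ac)
  also have "\<dots> < real (n ^ \<rho>) * 1"
    using small \<open>n > 0\<close> unfolding q_def by (intro mult_strict_left_mono) auto
  finally have "card (\<Union>K\<in>\<K>. bad K) < card F" by (simp add: cardF flip: of_nat_power)
  then have "\<not> F \<subseteq> (\<Union>K\<in>\<K>. bad K)"
  proof (rule contrapos_pn)
    assume "F \<subseteq> (\<Union>K\<in>\<K>. bad K)"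
    then have "F = (\<Union>K\<in>\<K>. bad K)" by (auto simp: bad_def)
    then show "\<not> card (\<Union>K\<in>\<K>. bad K) < card F" by simp
  qed
  then obtain x where x: "x \<in> F" "\<And>K. K \<in> \<K> \<Longrightarrow> x \<notin> bad K" by blast
  let ?R = "x ` {..<\<rho>}"
  have "real (card X) \<le> n / r"
    if "Y \<subseteq> ?R" "card Y \<le> k" "X \<in> V Y" "X \<subseteq> B" "X \<inter> ?R = {}" for X Y
  proof -
    \<comment> \<open>One position is picked for each element of \<open>Y\<close>, so that
      \<open>K\<close> is no larger than \<open>Y\<close> even if values repeat in the
      sample.\<close>
    obtain K where K: "K \<subseteq> {..<\<rho>}" "inj_on x K" "Y = x ` K"
      using \<open>Y \<subseteq> ?R\<close> by (meson subset_image_inj)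
    then have "K \<in> \<K>" using that(2) by (simp add: \<K>_def card_image)
    show ?thesis
    proof (rule ccontr)
      assume "\<not> real (card X) \<le> n / r"
      then have "X \<in> V' (x ` K)" using that K(3) by (simp add: V'_def)
      then have "x \<in> bad K" using x(1) that(5) unfolding bad_def by blast
      then show False using x(2)[OF \<open>K \<in> \<K>\<close>] by contradiction
    qed
  qed
  moreover have "?R \<subseteq> B" using x(1) by (auto simp: F_def)
  moreover have "card ?R \<le> \<rho>" using card_image_le[of "{..<\<rho>}" x] by simp
  ultimately show ?thesis unfolding n_def by blast
qed

text \<open>Repetitions give all coverings the same index set, independent of the perturbation, so
  that limits can be taken index by index.\<close>

lemma enumerate_padded:
  assumes "finite X" "X \<noteq> {}" "card X \<le> N"
  shows "\<exists>h::nat \<Rightarrow> 'x. h ` {..<N} = X \<and> range h \<subseteq> X"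
proof -
  obtain h where h: "bij_betw h {0..<card X} X"
    using ex_bij_betw_nat_finite[OF assms(1)] by blast
  obtain x where "x \<in> X" using assms(2) by blast
  let ?h = "\<lambda>i. if i < card X then h i else x"
  have "h ` {0..<card X} = X" using h by (simp add: bij_betw_def)
  then have "range ?h \<subseteq> X" using \<open>x \<in> X\<close> by auto
  moreover have "X \<subseteq> ?h ` {..<N}"
  proof
    fix y assume "y \<in> X"
    then have "y \<in> h ` {0..<card X}" using \<open>h ` {0..<card X} = X\<close> by simp
    then obtain i where "i < card X" "y = h i" by auto
    then show "y \<in> ?h ` {..<N}" using assms(3) by (intro image_eqI[of _ _ i]) auto
  qed
  ultimately show ?thesis by (intro exI[of _ ?h]) blast
qed

text \<open>The constraints in \<open>E\<close> bound the region and are always kept; only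
  \<open>B\<close> is sampled. A vertex of the sampled polytope violates no sampled constraint, and
  its conflict set is determined by its active constraints, at most \<open>DIM('e)\<close> of which
  are sampled. The sampling lemma therefore limits its conflicts. That all points stay in the
  polyhedron of \<open>E\<close> supplies the compactness for the later limit.\<close>

lemma cutting_general_position:
  fixes g :: "'i \<Rightarrow> 'e::euclidean_space"
  assumes fin: "finite E" "finite B" and "B \<noteq> {}" and gp: "general_position (E \<union> B) g \<beta>"
    and bdd: "bounded (polyhedron_of E g \<beta>)" and ne: "polyhedron_of (E \<union> B) g \<beta> \<noteq> {}" and "r \<ge> 1"
    and small: "real ((DIM('e) + 1) * (\<rho> + 1) ^ DIM('e)) * (real (2 ^ (card E + DIM('e))) * (1 - 1 / r) ^ (\<rho> - DIM('e))) < 1"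
    and N: "2 * ((DIM('e) div 2 + 1) * (card E + \<rho> + 1) ^ (DIM('e) div 2)) * ((DIM('e) + 1) * (DIM('e) + 1) ^ DIM('e)) \<le> N"
  shows "\<exists>f::nat \<Rightarrow> nat \<Rightarrow> 'e. (\<forall>i j. f i j \<in> polyhedron_of E g \<beta>) \<and>
           (\<forall>i j. real (card {b\<in>B. \<beta> b < g b \<bullet> f i j}) \<le> card B / r) \<and>
           (\<forall>a\<in>polyhedron_of (E \<union> B) g \<beta>. \<exists>i<N. a \<in> convex hull (f i ` {..DIM('e)}))"
proof -
  define pt where "pt T = (SOME x. \<forall>i\<in>T. g i \<bullet> x = \<beta> i)" for T
  define conf where "conf x = {b\<in>B. \<beta> b < g b \<bullet> x}" for x
  \<comment> \<open>The conflict sets of all points cut out by subfamilies of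
    \<open>E \<union> Y\<close>. For a subfamily that does not determine a point, \<open>pt\<close>
    is arbitrary, which only adds candidates to the family.\<close>
  define V where "V Y = (\<lambda>T. conf (pt T)) ` Pow (E \<union> Y)" for Y
  have V: "finite (V Y) \<and> card (V Y) \<le> 2 ^ (card E + DIM('e))" if "Y \<subseteq> B" "card Y \<le> DIM('e)" for Y
  proof -
    have finEY: "finite (E \<union> Y)" using fin that finite_subset by blast
    have "card (V Y) \<le> card (Pow (E \<union> Y))"
      unfolding V_def using finEY by (intro card_image_le) simp
    also have "\<dots> = 2 ^ card (E \<union> Y)" by (rule card_Pow[OF finEY])
    also have "\<dots> \<le> 2 ^ (card E + DIM('e))"
      using card_Un_le[of E Y] that(2) by (intro power_increasing) auto
    finally show ?thesis using finEY by (simp add: V_def)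
  qed
  have "\<exists>R\<subseteq>B. card R \<le> \<rho> \<and> (\<forall>Y\<subseteq>R. card Y \<le> DIM('e) \<longrightarrow>
          (\<forall>X\<in>V Y. X \<subseteq> B \<longrightarrow> X \<inter> R = {} \<longrightarrow> real (card X) \<le> card B / r))"
    by (rule sample_avoiding_large_conflicts[OF fin(2) \<open>r \<ge> 1\<close> _ \<open>B \<noteq> {}\<close> small]) (rule V)
  then obtain R where R: "R \<subseteq> B" "card R \<le> \<rho>"
    "\<forall>Y\<subseteq>R. card Y \<le> DIM('e) \<longrightarrow> (\<forall>X\<in>V Y. X \<subseteq> B \<longrightarrow> X \<inter> R = {} \<longrightarrow> real (card X) \<le> card B / r)"
    by (elim exE conjE)
  let ?S = "E \<union> R"
  obtain c where c: "generic_objective ?S g c"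
    using exists_generic_objective fin R(1) finite_subset by (metis finite_UnI)
  interpret generic_polytope ?S g \<beta> c
  proof
    show "finite ?S" using fin R(1) finite_subset by blast
    show "general_position ?S g \<beta>" using general_position_subset[OF gp] R(1) by blast
    show "bounded (polyhedron_of ?S g \<beta>)"
      by (rule bounded_subset[OF bdd]) (auto simp: polyhedron_of_def)
  qed (rule c)
  obtain \<T> where \<T>: "finite \<T>"
     "card \<T> \<le> 2 * ((DIM('e) div 2 + 1) * (card ?S + 1) ^ (DIM('e) div 2)) * ((DIM('e) + 1) * (DIM('e) + 1) ^ DIM('e))"
     "\<And>T. T \<in> \<T> \<Longrightarrow> T \<subseteq> vertices \<and> T \<noteq> {} \<and> card T \<le> DIM('e) + 1"
     "\<And>a. a \<in> polyhedron_of ?S g \<beta> \<Longrightarrow> \<exists>T\<in>\<T>. a \<in> convex hull T"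
    using simplicial_cover by blast
  have "card ?S \<le> card E + \<rho>" using card_Un_le[of E R] R(2) by linarith
  then have "card \<T> \<le> N"
    by (intro order_trans[OF \<T>(2) order_trans[OF _ N]] mult_right_mono mult_left_mono power_mono) auto
  have sub: "polyhedron_of (E \<union> B) g \<beta> \<subseteq> polyhedron_of ?S g \<beta>"
    using R(1) by (auto simp: polyhedron_of_def)
  then have "\<T> \<noteq> {}" using \<T>(4) ne by blast
  then obtain h where h: "h ` {..<N} = \<T>" "range h \<subseteq> \<T>"
    using enumerate_padded[OF \<T>(1) _ \<open>card \<T> \<le> N\<close>] by blast
  have "\<exists>e::nat \<Rightarrow> 'e. e ` {..<DIM('e) + 1} = h i \<and> range e \<subseteq> h i" for i
  proof (rule enumerate_padded)
    have "h i \<in> \<T>" using h(2) by blast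
    from \<T>(3)[OF this] show "finite (h i)" "h i \<noteq> {}" "card (h i) \<le> DIM('e) + 1"
      using finite_vertices finite_subset by auto
  qed
  then obtain f where f: "\<And>i. f i ` {..<DIM('e) + 1} = h i" "\<And>i. range (f i) \<subseteq> h i" by metis
  have fv: "f i j \<in> vertices" for i j
    using f(2)[of i] h(2) \<T>(3)[of "h i"] by blast
  have conf_vertex: "real (card (conf v)) \<le> card B / r" if v: "v \<in> vertices" for v
  proof (rule R(3)[rule_format])
    let ?T = "act v"
    have "\<forall>i\<in>?T. g i \<bullet> pt ?T = \<beta> i"
      unfolding pt_def by (rule someI[of _ v]) (auto simp: active_def)
    then have "g i \<bullet> pt ?T = g i \<bullet> v" if "i \<in> ?T" for i using that by (auto simp: active_def)
    then have "pt ?T = v" by (rule eq_if_active_spanning[OF span_act[OF v]])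
    then show "conf v \<in> V (?T \<inter> R)"
      unfolding V_def by (intro image_eqI[of _ _ ?T]) (auto simp: active_def)
    show "?T \<inter> R \<subseteq> R" "conf v \<subseteq> B" by (auto simp: conf_def)
    have "card (?T \<inter> R) \<le> card ?T" by (intro card_mono) auto
    then show "card (?T \<inter> R) \<le> DIM('e)" using v by (simp add: vertices_def)
    show "conf v \<inter> R = {}" using v by (auto simp: conf_def vertices_def polyhedron_of_def not_le[symmetric])
  qed
  show ?thesis
  proof (intro exI[of _ f] conjI allI ballI)
    fix i j
    show "f i j \<in> polyhedron_of E g \<beta>" using fv[of i j] by (auto simp: vertices_def polyhedron_of_def)
    show "real (card {b\<in>B. \<beta> b < g b \<bullet> f i j}) \<le> card B / r"
      using conf_vertex[OF fv[of i j]] by (simp add: conf_def)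
  next
    fix a assume "a \<in> polyhedron_of (E \<union> B) g \<beta>"
    then obtain T where "T \<in> \<T>" "a \<in> convex hull T" using \<T>(4) sub by blast
    moreover from this obtain i where "i < N" "h i = T" using h(1) by blast
    ultimately show "\<exists>i<N. a \<in> convex hull (f i ` {..DIM('e)})"
      using f(1)[of i] by (auto simp: lessThan_Suc_atMost)
  qed
qed

section \<open>Perturbation into general position\<close>

lemma dependent_family_relation:
  fixes g :: "'i \<Rightarrow> 'e::euclidean_space"
  assumes "finite T" "\<not> indep_family g T"
  shows "\<exists>\<mu>. (\<Sum>i\<in>T. \<mu> i *\<^sub>R g i) = 0 \<and> (\<exists>i\<in>T. \<mu> i \<noteq> 0)"
proof (cases "inj_on g T")
  case True
  then have "dependent (g ` T)" using assms(2) by (simp add: indep_family_def)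
  then obtain u where "\<exists>v\<in>g ` T. u v \<noteq> 0" "(\<Sum>v\<in>g ` T. u v *\<^sub>R v) = 0"
    using assms(1) by (auto simp: dependent_finite)
  then show ?thesis
    using sum.reindex[OF True, of "\<lambda>v. u v *\<^sub>R v"] by (intro exI[of _ "\<lambda>i. u (g i)"]) auto
next
  case False
  then obtain i j where ij: "i \<in> T" "j \<in> T" "i \<noteq> j" "g i = g j" by (auto simp: inj_on_def)
  define \<mu> where "\<mu> k = (if k = i then 1 else if k = j then - 1 else 0 :: real)" for k
  have "(\<Sum>k\<in>T. \<mu> k *\<^sub>R g k) = (\<Sum>k\<in>{i, j}. \<mu> k *\<^sub>R g k)"
    by (rule sum.mono_neutral_right) (use assms(1) ij in \<open>auto simp: \<mu>_def\<close>)
  also have "\<dots> = 0" using ij by (simp add: \<mu>_def)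
  finally show ?thesis using ij(1) by (intro exI[of _ \<mu>]) (auto simp: \<mu>_def)
qed

text \<open>Shift the constraints by distinct powers of \<open>\<tau>\<close>: a dependent family of constraints has a common
  solution only if \<open>\<tau>\<close> is a root of a fixed nonzero polynomial.\<close>

lemma general_position_perturbation:
  fixes g :: "'i \<Rightarrow> 'e::euclidean_space"
  assumes "finite I" "\<delta> > 0"
  shows "\<exists>\<beta>'. (\<forall>i\<in>I. \<beta> i \<le> \<beta>' i \<and> \<beta>' i \<le> \<beta> i + \<delta>) \<and> general_position I g \<beta>'"
proof -
  obtain e :: "'i \<Rightarrow> nat" where e: "inj_on e I"
    using assms(1) finite_imp_inj_to_nat_seg by blast
  \<comment> \<open>Exponents start at 1: the shifts are then at most \<tau> for \<tau> below 1, and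
    in the polynomial \<open>p\<close> below they stay apart from the constant term, so that the
    coefficient at \<open>Suc (e k)\<close> is exactly \<open>\<mu> k\<close>.\<close>
  define \<beta>' where "\<beta>' \<tau> i = \<beta> i + \<tau> ^ Suc (e i)" for \<tau> i
  define bad where "bad T = {\<tau>. \<exists>x. \<forall>i\<in>T. g i \<bullet> x = \<beta>' \<tau> i}" for T
  have fin_bad: "finite (bad T)" if T: "T \<subseteq> I" "\<not> indep_family g T" for T
  proof -
    have "finite T" using T(1) assms(1) finite_subset by blast
    then obtain \<mu> k where \<mu>: "(\<Sum>i\<in>T. \<mu> i *\<^sub>R g i) = 0" "k \<in> T" "\<mu> k \<noteq> 0"
      using dependent_family_relation[OF _ T(2)] by blast
    define p where "p = [:\<Sum>i\<in>T. \<mu> i * \<beta> i:] + (\<Sum>i\<in>T. monom (\<mu> i) (Suc (e i)))"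
    have ek: "e i = e k \<longleftrightarrow> i = k" if "i \<in> T" for i
      using e T(1) \<mu>(2) that by (meson inj_on_eq_iff subsetD)
    have "coeff p (Suc (e k)) = (\<Sum>i\<in>T. if e i = e k then \<mu> i else 0)"
      unfolding p_def by (simp add: coeff_sum)
    also have "\<dots> = (\<Sum>i\<in>T. if i = k then \<mu> i else 0)"
      by (rule sum.cong) (simp_all add: ek)
    also have "\<dots> = \<mu> k" using \<open>finite T\<close> \<mu>(2) by simp
    finally have "p \<noteq> 0" using \<mu>(3) by auto
    have "bad T \<subseteq> {\<tau>. poly p \<tau> = 0}"
    proof
      fix \<tau> assume "\<tau> \<in> bad T"
      then obtain x where x: "\<And>i. i \<in> T \<Longrightarrow> g i \<bullet> x = \<beta>' \<tau> i" by (auto simp: bad_def)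
      have "poly p \<tau> = (\<Sum>i\<in>T. \<mu> i * \<beta>' \<tau> i)"
        by (simp add: p_def \<beta>'_def poly_sum poly_monom sum.distrib distrib_left)
      also have "\<dots> = (\<Sum>i\<in>T. \<mu> i *\<^sub>R g i) \<bullet> x"
        using x by (simp add: inner_sum_left)
      finally show "\<tau> \<in> {\<tau>. poly p \<tau> = 0}" using \<mu>(1) by simp
    qed
    then show ?thesis using poly_roots_finite[OF \<open>p \<noteq> 0\<close>] finite_subset by blast
  qed
  let ?Bad = "\<Union>T\<in>{T. T \<subseteq> I \<and> \<not> indep_family g T}. bad T"
  have "finite ?Bad" using assms(1) fin_bad by auto
  moreover have "infinite {0<..<min \<delta> 1}" using assms(2) by (simp add: infinite_Ioo)
  ultimately have "\<not> {0<..<min \<delta> 1} \<subseteq> ?Bad" using finite_subset by blast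
  then obtain \<tau> where "\<tau> \<in> {0<..<min \<delta> 1}" and \<tau>_good: "\<tau> \<notin> ?Bad" by blast
  then have \<tau>: "0 < \<tau>" "\<tau> < \<delta>" "\<tau> < 1" by simp_all
  have "\<tau> ^ Suc n \<le> \<delta>" for n
    using power_Suc_le_self[of \<tau> n] \<tau> by linarith
  then have "\<forall>i\<in>I. \<beta> i \<le> \<beta>' \<tau> i \<and> \<beta>' \<tau> i \<le> \<beta> i + \<delta>"
    using \<tau>(1) by (simp add: \<beta>'_def)
  moreover have "general_position I g (\<beta>' \<tau>)"
    unfolding general_position_def
  proof (intro allI)
    fix x
    have "active I g (\<beta>' \<tau>) x \<subseteq> I" "\<tau> \<in> bad (active I g (\<beta>' \<tau>) x)"
      by (auto simp: active_def bad_def)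
    then show "indep_family g (active I g (\<beta>' \<tau>) x)" using \<tau>_good by blast
  qed
  ultimately show ?thesis by blast
qed

section \<open>Removing general position by a limit\<close>

lemma convergent_subsequence_family:
  fixes F :: "nat \<Rightarrow> 'p \<Rightarrow> 'e::metric_space"
  assumes "finite P" "compact K" "\<And>k p. F k p \<in> K"
  shows "\<exists>l \<sigma>. strict_mono (\<sigma>::nat\<Rightarrow>nat) \<and> (\<forall>p\<in>P. (\<lambda>k. F (\<sigma> k) p) \<longlonglongrightarrow> l p)"
  using assms(1)
proof induction
  case empty
  show ?case by (rule exI, rule exI[of _ id]) (simp add: strict_mono_def)
next
  case (insert q P)
  then obtain l \<sigma> where l: "strict_mono \<sigma>" "\<And>p. p \<in> P \<Longrightarrow> (\<lambda>k. F (\<sigma> k) p) \<longlonglongrightarrow> l p" by blast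
  have "seq_compact K" using assms(2) compact_imp_seq_compact by blast
  then obtain y \<sigma>' where y: "strict_mono \<sigma>'" "((\<lambda>k. F (\<sigma> k) q) \<circ> \<sigma>') \<longlonglongrightarrow> y"
    by (rule seq_compactE[of K "\<lambda>k. F (\<sigma> k) q"]) (use assms(3) in auto)
  have "(\<lambda>k. F ((\<sigma> \<circ> \<sigma>') k) p) \<longlonglongrightarrow> (l(q := y)) p" if "p \<in> insert q P" for p
  proof (cases "p = q")
    case True
    then show ?thesis using y(2) by (simp add: o_def)
  next
    case False
    then show ?thesis
      using that LIMSEQ_subseq_LIMSEQ[OF l(2) y(1)] by (simp add: o_def)
  qed
  moreover have "strict_mono (\<sigma> \<circ> \<sigma>')" using l(1) y(1) by (rule strict_mono_o)
  ultimately show ?case by blast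
qed

text \<open>Cut systems loosened by at most \<open>1 / Suc k\<close> and let the simplices converge
  along a subsequence; the slack 1 in the boundedness hypothesis covers all these loosenings. A
  constraint violated at a limit point is violated strictly, hence also at late stages, which
  preserves the conflict counts. A point outside all limit simplices is strictly separated from each
  of them, hence outside all late simplices, which contradicts covering.\<close>

lemma halfspace_cutting:
  fixes g :: "'i \<Rightarrow> 'e::euclidean_space"
  assumes fin: "finite E" "finite B" and "B \<noteq> {}"
    and bdd: "bounded (polyhedron_of E g (\<lambda>i. \<beta> i + 1))" and ne: "polyhedron_of (E \<union> B) g \<beta> \<noteq> {}" and "r \<ge> 1"
    and small: "real ((DIM('e) + 1) * (\<rho> + 1) ^ DIM('e)) * (real (2 ^ (card E + DIM('e))) * (1 - 1 / r) ^ (\<rho> - DIM('e))) < 1"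
    and N: "2 * ((DIM('e) div 2 + 1) * (card E + \<rho> + 1) ^ (DIM('e) div 2)) * ((DIM('e) + 1) * (DIM('e) + 1) ^ DIM('e)) \<le> N"
  shows "\<exists>f::nat \<Rightarrow> nat \<Rightarrow> 'e.
           (\<forall>i<N. \<forall>j\<le>DIM('e). real (card {b\<in>B. \<beta> b < g b \<bullet> f i j}) \<le> card B / r) \<and>
           (\<forall>a\<in>polyhedron_of (E \<union> B) g \<beta>. \<exists>i<N. a \<in> convex hull (f i ` {..DIM('e)}))"
proof -
  let ?D = "DIM('e)"
  have "\<exists>\<beta>'. (\<forall>i\<in>E \<union> B. \<beta> i \<le> \<beta>' i \<and> \<beta>' i \<le> \<beta> i + 1 / Suc k) \<and> general_position (E \<union> B) g \<beta>'" for k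
    using general_position_perturbation[of "E \<union> B" "1 / Suc k" \<beta> g] fin by simp
  then obtain \<beta>' where \<beta>': "\<And>k i. i \<in> E \<union> B \<Longrightarrow> \<beta> i \<le> \<beta>' k i"
      "\<And>k i. i \<in> E \<union> B \<Longrightarrow> \<beta>' k i \<le> \<beta> i + 1 / Suc k" "\<And>k. general_position (E \<union> B) g (\<beta>' k)"
    by metis
  have sub: "polyhedron_of E g (\<beta>' k) \<subseteq> polyhedron_of E g (\<lambda>i. \<beta> i + 1)" for k
  proof -
    have "\<beta>' k i \<le> \<beta> i + 1" if "i \<in> E" for i
    proof -
      have "1 / real (Suc k) \<le> 1" by simp
      moreover have "\<beta>' k i \<le> \<beta> i + 1 / Suc k" using \<beta>'(2) that by blast
      ultimately show ?thesis by linarith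
    qed
    then show ?thesis unfolding polyhedron_of_def by (blast intro: order_trans)
  qed
  have sup: "polyhedron_of (E \<union> B) g \<beta> \<subseteq> polyhedron_of (E \<union> B) g (\<beta>' k)" for k
    using \<beta>'(1) unfolding polyhedron_of_def by (blast intro: order_trans)
  define good where "good k f \<longleftrightarrow> (\<forall>i j. f i j \<in> polyhedron_of E g (\<beta>' k)) \<and>
           (\<forall>i j. real (card {b\<in>B. \<beta>' k b < g b \<bullet> f i j}) \<le> card B / r) \<and>
           (\<forall>a\<in>polyhedron_of (E \<union> B) g (\<beta>' k). \<exists>i<N. a \<in> convex hull (f i ` {..?D}))"
    for k and f :: "nat \<Rightarrow> nat \<Rightarrow> 'e"
  have "\<exists>f. good k f" for k
    unfolding good_def using sup[of k] ne
    by (intro cutting_general_position[OF fin \<open>B \<noteq> {}\<close> \<beta>'(3) bounded_subset[OF bdd sub] _ \<open>r \<ge> 1\<close> small N]) blast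
  then obtain f where "\<And>k. good k (f k)" by metis
  then have f: "\<And>k i j. f k i j \<in> polyhedron_of E g (\<beta>' k)"
      "\<And>k i j. real (card {b\<in>B. \<beta>' k b < g b \<bullet> f k i j}) \<le> card B / r"
      "\<And>k a. a \<in> polyhedron_of (E \<union> B) g (\<beta>' k) \<Longrightarrow> \<exists>i<N. a \<in> convex hull (f k i ` {..?D})"
    unfolding good_def by blast+
  let ?K = "closure (polyhedron_of E g (\<lambda>i. \<beta> i + 1))"
  obtain l \<sigma> where \<sigma>: "strict_mono \<sigma>"
      and l: "\<And>p. p \<in> {..<N} \<times> {..?D} \<Longrightarrow> (\<lambda>k. f (\<sigma> k) (fst p) (snd p)) \<longlonglongrightarrow> l p"
    using convergent_subsequence_family[of "{..<N} \<times> {..?D}" ?K "\<lambda>k p. f k (fst p) (snd p)"]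
      bdd f(1) sub closure_subset by (fastforce simp: compact_closure)
  have lim: "(\<lambda>k. f (\<sigma> k) i j) \<longlonglongrightarrow> l (i, j)" if "i < N" "j \<le> ?D" for i j
    using l[of "(i, j)"] that by simp
  have \<beta>'_lim: "(\<lambda>k. \<beta>' (\<sigma> k) i) \<longlonglongrightarrow> \<beta> i" if "i \<in> E \<union> B" for i
  proof -
    have "(\<lambda>k. \<beta>' k i) \<longlonglongrightarrow> \<beta> i"
    proof (rule tendsto_sandwich[of "\<lambda>_. \<beta> i" _ _ "\<lambda>k. \<beta> i + 1 / Suc k"])
      show "(\<lambda>k. \<beta> i + 1 / Suc k) \<longlonglongrightarrow> \<beta> i"
        using tendsto_add[OF tendsto_const LIMSEQ_inverse_real_of_nat, of "\<beta> i"]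
        by (simp add: inverse_eq_divide)
    qed (use \<beta>'(1,2) that in auto)
    then show ?thesis using LIMSEQ_subseq_LIMSEQ[OF _ \<sigma>] by (fastforce simp: o_def)
  qed
  show ?thesis
  proof (intro exI[of _ "\<lambda>i j. l (i, j)"] conjI allI impI ballI)
    fix i j assume ij: "i < N" "j \<le> ?D"
    let ?X = "{b\<in>B. \<beta> b < g b \<bullet> l (i, j)}"
    have "\<forall>\<^sub>F k in sequentially. \<beta>' (\<sigma> k) b < g b \<bullet> f (\<sigma> k) i j" if "b \<in> ?X" for b
    proof -
      have "(\<lambda>k. g b \<bullet> f (\<sigma> k) i j - \<beta>' (\<sigma> k) b) \<longlonglongrightarrow> g b \<bullet> l (i, j) - \<beta> b"
        using that by (intro tendsto_intros lim[OF ij] \<beta>'_lim) simp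
      then have "\<forall>\<^sub>F k in sequentially. 0 < g b \<bullet> f (\<sigma> k) i j - \<beta>' (\<sigma> k) b"
        by (rule order_tendstoD(1)) (use that in simp)
      then show ?thesis by (rule eventually_mono) simp
    qed
    then have "\<forall>\<^sub>F k in sequentially. \<forall>b\<in>?X. \<beta>' (\<sigma> k) b < g b \<bullet> f (\<sigma> k) i j"
      using fin(2) by (intro eventually_ball_finite) auto
    then obtain k where "\<forall>b\<in>?X. \<beta>' (\<sigma> k) b < g b \<bullet> f (\<sigma> k) i j"
      using eventually_happens'[OF sequentially_bot] by blast
    then have "card ?X \<le> card {b\<in>B. \<beta>' (\<sigma> k) b < g b \<bullet> f (\<sigma> k) i j}"
      using fin(2) by (intro card_mono) auto
    then show "real (card ?X) \<le> card B / r" using f(2)[of "\<sigma> k" i j] by linarith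
  next
    fix a assume a: "a \<in> polyhedron_of (E \<union> B) g \<beta>"
    show "\<exists>i<N. a \<in> convex hull ((\<lambda>j. l (i, j)) ` {..?D})"
    proof (rule ccontr)
      assume contra: "\<not> ?thesis"
      have "\<forall>\<^sub>F k in sequentially. a \<notin> convex hull (f (\<sigma> k) i ` {..?D})" if i: "i < N" for i
      proof -
        let ?H = "convex hull ((\<lambda>j. l (i, j)) ` {..?D})"
        have "a \<notin> ?H" using contra i by blast
        moreover have "closed ?H" by (simp add: compact_imp_closed finite_imp_compact_convex_hull)
        ultimately obtain w b where w: "w \<bullet> a < b" "\<And>x. x \<in> ?H \<Longrightarrow> w \<bullet> x > b"
          using separating_hyperplane_closed_point[of ?H a] by auto
        have "\<forall>\<^sub>F k in sequentially. w \<bullet> f (\<sigma> k) i j > b" if "j \<in> {..?D}" for j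
        proof (rule order_tendstoD(1))
          show "(\<lambda>k. w \<bullet> f (\<sigma> k) i j) \<longlonglongrightarrow> w \<bullet> l (i, j)"
            using that by (intro tendsto_intros lim[OF i]) simp
          show "b < w \<bullet> l (i, j)" using that by (intro w(2) hull_inc) simp
        qed
        then have "\<forall>\<^sub>F k in sequentially. \<forall>j\<in>{..?D}. w \<bullet> f (\<sigma> k) i j > b"
          by (simp add: eventually_ball_finite)
        then show ?thesis
        proof (rule eventually_mono)
          fix k assume k: "\<forall>j\<in>{..?D}. w \<bullet> f (\<sigma> k) i j > b"
          have "convex hull (f (\<sigma> k) i ` {..?D}) \<subseteq> {x. w \<bullet> x > b}"
            by (rule hull_minimal) (use k in \<open>auto simp: convex_halfspace_gt\<close>)
          then show "a \<notin> convex hull (f (\<sigma> k) i ` {..?D})" using w(1) by auto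
        qed
      qed
      then have "\<forall>\<^sub>F k in sequentially. \<forall>i\<in>{..<N}. a \<notin> convex hull (f (\<sigma> k) i ` {..?D})"
        by (intro eventually_ball_finite) auto
      then obtain k where "\<forall>i\<in>{..<N}. a \<notin> convex hull (f (\<sigma> k) i ` {..?D})"
        using eventually_happens'[OF sequentially_bot] by blast
      moreover have "a \<in> polyhedron_of (E \<union> B) g (\<beta>' (\<sigma> k))" using a sup by blast
      ultimately show False using f(3) by blast
    qed
  qed
qed

section \<open>Unit distances in a set of diameter 1\<close>

text \<open>The slack at \<open>x\<close> is the weighted mean of the nonnegative slacks at the
  points of \<open>T\<close>, so it vanishes exactly when they vanish wherever the weight is
  positive.\<close>

lemma tight_convex_combination:
  fixes w x :: "'e::euclidean_space"
  assumes "finite T" "\<And>y. y \<in> T \<Longrightarrow> 0 \<le> u y" "sum u T = 1" "x = (\<Sum>y\<in>T. u y *\<^sub>R y)"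
    and "\<And>y. y \<in> T \<Longrightarrow> w \<bullet> y \<le> \<beta>"
  shows "w \<bullet> x = \<beta> \<longleftrightarrow> (\<forall>y\<in>T. u y > 0 \<longrightarrow> w \<bullet> y = \<beta>)"
proof -
  have "\<beta> - w \<bullet> x = (\<Sum>y\<in>T. u y * \<beta>) - (\<Sum>y\<in>T. u y * (w \<bullet> y))"
    using assms(3) by (simp add: assms(4) inner_sum_right flip: sum_distrib_right)
  also have "\<dots> = (\<Sum>y\<in>T. u y * (\<beta> - w \<bullet> y))"
    by (simp add: right_diff_distrib sum_subtractf)
  finally have "w \<bullet> x = \<beta> \<longleftrightarrow> (\<Sum>y\<in>T. u y * (\<beta> - w \<bullet> y)) = 0" by linarith
  also have "\<dots> \<longleftrightarrow> (\<forall>y\<in>T. u y * (\<beta> - w \<bullet> y) = 0)"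
    using assms by (intro sum_nonneg_eq_0_iff) auto
  also have "\<dots> \<longleftrightarrow> (\<forall>y\<in>T. u y > 0 \<longrightarrow> w \<bullet> y = \<beta>)"
    using assms(2) by (force simp: less_le)
  finally show ?thesis .
qed

lemma Kuu_free_subset:
  assumes "Kuu_free u A B" "A' \<subseteq> A" "B' \<subseteq> B"
  shows "Kuu_free u A' B'"
  unfolding Kuu_free_def
proof (intro notI, elim exE conjE)
  fix X Y
  assume "X \<subseteq> A'" "Y \<subseteq> B'" "card X = u" "card Y = u" "finite X" "finite Y" "\<forall>a\<in>X. \<forall>b\<in>Y. dist a b = 1"
  moreover from this have "X \<subseteq> A" "Y \<subseteq> B" using assms(2,3) by auto
  ultimately show False using assms(1) unfolding Kuu_free_def by blast
qed

lemma Kuu_free_commute: "Kuu_free u A B \<Longrightarrow> Kuu_free u B A"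
  unfolding Kuu_free_def by (metis dist_commute)

text \<open>For \<open>u = 0\<close> two empty sets would form the excluded subgraph.\<close>

lemma Kuu_free_pos: "Kuu_free u A B \<Longrightarrow> u > 0"
  unfolding Kuu_free_def by (metis card.empty empty_iff empty_subsetI finite.emptyI gr0I)

text \<open>One side has at most \<open>u\<close> points, and the product is then at most
  \<open>u\<close> times the other side.\<close>

lemma complete_bipartite_le:
  assumes "Kuu_free u A B" "X \<subseteq> A" "Y \<subseteq> B" "finite X" "finite Y"
    and "\<And>a b. a \<in> X \<Longrightarrow> b \<in> Y \<Longrightarrow> dist a b = 1"
  shows "card X * card Y \<le> u * (card X + card Y)"
proof (cases "u \<le> card X \<and> u \<le> card Y")
  case True
  then obtain X' Y' where "X' \<subseteq> X" "card X' = u" "Y' \<subseteq> Y" "card Y' = u"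
    by (meson obtain_subset_with_card_n)
  moreover from this have "finite X'" "finite Y'" "X' \<subseteq> A" "Y' \<subseteq> B" "\<forall>a\<in>X'. \<forall>b\<in>Y'. dist a b = 1"
    using assms finite_subset by blast+
  ultimately have "\<not> Kuu_free u A B" unfolding Kuu_free_def by blast
  then show ?thesis using assms(1) by contradiction
next
  case False
  then have "card X \<le> u \<or> card Y \<le> u" by linarith
  then show ?thesis
  proof
    assume "card X \<le> u"
    then have "card X * card Y \<le> u * card Y" by (rule mult_right_mono) simp
    then show ?thesis unfolding distrib_left by (rule trans_le_add2)
  next
    assume "card Y \<le> u"
    then have "card X * card Y \<le> card X * u" by (rule mult_left_mono) simp
    then show ?thesis unfolding distrib_left mult.commute[of u] by (rule trans_le_add1)
  qed
qed

lemma finite_unit_dist_edges: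
  assumes "finite A" "finite B"
  shows "finite (unit_dist_edges A B)" "card (unit_dist_edges A B) \<le> card A * card B"
proof -
  have sub: "unit_dist_edges A B \<subseteq> A \<times> B" by (auto simp: unit_dist_edges_def)
  then show "finite (unit_dist_edges A B)" using assms finite_subset by blast
  show "card (unit_dist_edges A B) \<le> card A * card B"
    using card_mono[OF _ sub] assms by (simp add: card_cartesian_product)
qed

lemma card_unit_dist_edges_commute: "card (unit_dist_edges A B) = card (unit_dist_edges B A)"
proof -
  have "unit_dist_edges B A = prod.swap ` unit_dist_edges A B"
    by (auto simp: unit_dist_edges_def dist_commute image_iff)
  then show ?thesis by (simp add: card_image)
qed

text \<open>On the paraboloid \<open>x = (p, p \<bullet> p)\<close> the condition \<open>dist p q \<le> 1\<close> is a halfspace in \<open>x\<close>, with unit distances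
  on its boundary. The indices \<open>Inr\<close> add a large box. A cell is an index of a simplex together with the
  set of its vertices that span the smallest face containing the point.\<close>

lemma unit_distance_decomposition:
  fixes A B :: "'a::euclidean_space set"
  defines "k \<equiv> DIM('a \<times> real)"
  assumes fin: "finite A" "finite B" and ne: "A \<noteq> {}" "B \<noteq> {}"
    and dist: "\<And>a b. a \<in> A \<Longrightarrow> b \<in> B \<Longrightarrow> dist a b \<le> 1" and free: "Kuu_free u A B" and "r \<ge> 1"
    and small: "real ((k + 1) * (\<rho> + 1) ^ k) * (real (2 ^ (2 * k + k)) * (1 - 1 / r) ^ (\<rho> - k)) < 1"
    and N: "2 * ((k div 2 + 1) * (2 * k + \<rho> + 1) ^ (k div 2)) * ((k + 1) * (k + 1) ^ k) \<le> N"
  defines "\<C> \<equiv> {..<N} \<times> Pow {..k}"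
  shows "\<exists>Ac Bc. (\<forall>\<kappa>\<in>\<C>. Ac \<kappa> \<subseteq> A \<and> Bc \<kappa> \<subseteq> B \<and> real (card (Bc \<kappa>)) \<le> real (k + 1) * (card B / r)) \<and>
           (\<Sum>\<kappa>\<in>\<C>. card (Ac \<kappa>)) = card A \<and>
           card (unit_dist_edges A B) \<le> (\<Sum>\<kappa>\<in>\<C>. card (unit_dist_edges (Ac \<kappa>) (Bc \<kappa>))) + card \<C> * (u * (card A + card B))"
proof -
  define lift where "lift p = (p, p \<bullet> p)" for p :: 'a
  obtain R where R: "\<And>a. a \<in> A \<Longrightarrow> norm (lift a) \<le> R"
    using finite_imp_bounded[of "lift ` A"] fin(1) by (auto simp: bounded_iff)
  \<comment> \<open>Expanding the square turns \<open>dist p q \<le> 1\<close> into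
    \<open>p \<bullet> p - 2 * (q \<bullet> p) \<le> 1 - q \<bullet> q\<close>, which is linear in
    \<open>lift p\<close>.\<close>
  define g :: "'a + ('a \<times> real) \<times> bool \<Rightarrow> 'a \<times> real"
    where "g = case_sum (\<lambda>q. (- 2 *\<^sub>R q, 1)) (\<lambda>(b, s). if s then b else - b)"
  define \<beta> :: "'a + ('a \<times> real) \<times> bool \<Rightarrow> real"
    where "\<beta> = case_sum (\<lambda>q. 1 - q \<bullet> q) (\<lambda>_. R)"
  have g_lift: "\<beta> (Inl q) - g (Inl q) \<bullet> lift p = 1 - (dist p q)\<^sup>2" for p q
    by (simp add: g_def \<beta>_def lift_def dist_norm power2_norm_eq_inner inner_diff_left inner_diff_right
        inner_commute)
  define E :: "('a + ('a \<times> real) \<times> bool) set" where "E = Inr ` (Basis \<times> UNIV)"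
  have finE: "finite E" by (simp add: E_def)
  have cardE: "card E = 2 * k"
    by (simp add: E_def k_def card_image card_cartesian_product del: DIM_prod)
  define B' :: "('a + ('a \<times> real) \<times> bool) set" where "B' = Inl ` B"
  have cardB': "card B' = card B" and B': "finite B'" "B' \<noteq> {}"
    using fin ne by (auto simp: B'_def card_image)
  have bdd: "bounded (polyhedron_of E g (\<lambda>i. \<beta> i + 1))"
  proof (rule boundedI)
    fix x assume x: "x \<in> polyhedron_of E g (\<lambda>i. \<beta> i + 1)"
    have "g (Inr (b, s)) \<bullet> x \<le> R + 1" if "b \<in> Basis" for b s
    proof -
      have "Inr (b, s) \<in> E" using that by (simp add: E_def)
      then have "g (Inr (b, s)) \<bullet> x \<le> \<beta> (Inr (b, s)) + 1"
        using x unfolding polyhedron_of_def by blast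
      then show ?thesis by (simp add: \<beta>_def)
    qed
    from this[of _ True] this[of _ False] have "\<bar>x \<bullet> b\<bar> \<le> R + 1" if "b \<in> Basis" for b
      using that by (simp add: g_def abs_le_iff inner_commute)
    then have "(\<Sum>b\<in>Basis. \<bar>x \<bullet> b\<bar>) \<le> of_nat (card (Basis :: ('a \<times> real) set)) * (R + 1)"
      by (rule sum_bounded_above)
    then show "norm x \<le> of_nat (card (Basis :: ('a \<times> real) set)) * (R + 1)"
      using norm_le_l1[of x] by linarith
  qed
  have lift_poly: "lift a \<in> polyhedron_of (E \<union> B') g \<beta>" if a: "a \<in> A" for a
  proof -
    have "g i \<bullet> lift a \<le> \<beta> i" if iE: "i \<in> E" for i
    proof -
      obtain b s where i: "i = Inr (b, s)" "b \<in> Basis" using iE unfolding E_def by blast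
      have "\<bar>lift a \<bullet> b\<bar> \<le> R" using Basis_le_norm[OF i(2)] R[OF a] order_trans by blast
      then show ?thesis by (auto simp: i(1) g_def \<beta>_def inner_commute)
    qed
    moreover have "g (Inl b) \<bullet> lift a \<le> \<beta> (Inl b)" if "b \<in> B" for b
    proof -
      have "(dist a b)\<^sup>2 \<le> 1" using dist[OF a that] by (simp add: power_le_one)
      then show ?thesis using g_lift[of b a] by linarith
    qed
    ultimately show ?thesis by (auto simp: polyhedron_of_def B'_def)
  qed
  have "\<exists>f::nat \<Rightarrow> nat \<Rightarrow> 'a \<times> real.
         (\<forall>i<N. \<forall>j\<le>k. real (card {b \<in> B'. \<beta> b < g b \<bullet> f i j}) \<le> card B' / r) \<and>
         (\<forall>x\<in>polyhedron_of (E \<union> B') g \<beta>. \<exists>i<N. x \<in> convex hull (f i ` {..k}))"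
    unfolding k_def
  proof (rule halfspace_cutting[of E B' g \<beta> r \<rho> N])
    show "polyhedron_of (E \<union> B') g \<beta> \<noteq> {}" using lift_poly ne(1) by blast
  qed (use B' bdd finE cardE small N \<open>r \<ge> 1\<close> in \<open>simp_all add: k_def del: DIM_prod\<close>)
  then obtain f :: "nat \<Rightarrow> nat \<Rightarrow> 'a \<times> real" where
    f: "\<And>i j. i < N \<Longrightarrow> j \<le> k \<Longrightarrow> real (card {b \<in> B'. \<beta> b < g b \<bullet> f i j}) \<le> card B / r"
      "\<And>x. x \<in> polyhedron_of (E \<union> B') g \<beta> \<Longrightarrow> \<exists>i<N. x \<in> convex hull (f i ` {..k})"
    unfolding cardB' by blast
  \<comment> \<open>The weights are functions on the image, since \<open>f i\<close> may repeat
    points.\<close>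
  define combination where "combination a i w \<longleftrightarrow> i < N \<and> (\<forall>y\<in>f i ` {..k}. 0 \<le> w y) \<and>
      sum w (f i ` {..k}) = 1 \<and> lift a = (\<Sum>y\<in>f i ` {..k}. w y *\<^sub>R y)" for a i w
  have "\<exists>i w. combination a i w" if a: "a \<in> A" for a
  proof -
    obtain i where i: "i < N" "lift a \<in> convex hull (f i ` {..k})"
      using f(2)[OF lift_poly[OF a]] by blast
    from i(2) obtain w where w: "(\<forall>y\<in>f i ` {..k}. 0 \<le> w y) \<and> sum w (f i ` {..k}) = 1 \<and>
        (\<Sum>y\<in>f i ` {..k}. w y *\<^sub>R y) = lift a"
      unfolding convex_hull_finite[OF finite_imageI[OF finite_atMost]] mem_Collect_eq by (elim exE)
    with i(1) show ?thesis
      unfolding combination_def by (intro exI[of _ i] exI[of _ w]) simp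
  qed
  then obtain cell w where "\<And>a. a \<in> A \<Longrightarrow> combination a (cell a) (w a)" by metis
  then have cw: "\<And>a. a \<in> A \<Longrightarrow> cell a < N \<and> (\<forall>y\<in>f (cell a) ` {..k}. 0 \<le> w a y) \<and>
      sum (w a) (f (cell a) ` {..k}) = 1 \<and> lift a = (\<Sum>y\<in>f (cell a) ` {..k}. w a y *\<^sub>R y)"
    unfolding combination_def .
  \<comment> \<open>Besides the simplex, only the support of the weights is recorded: outside
    \<open>Bc\<close> it decides which constraints are tight. All points of a class thus have the
    same unit neighbours outside \<open>Bc\<close>, namely \<open>Yc\<close>.\<close>
  define cls where "cls a = (cell a, {j. j \<le> k \<and> w a (f (cell a) j) > 0})" for a
  define Ac where "Ac \<kappa> = {a \<in> A. cls a = \<kappa>}" for \<kappa>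
  define Bc where "Bc \<kappa> = {b \<in> B. \<exists>j\<le>k. \<beta> (Inl b) < g (Inl b) \<bullet> f (fst \<kappa>) j}" for \<kappa> :: "nat \<times> nat set"
  define Yc where "Yc \<kappa> = {b \<in> B - Bc \<kappa>. \<forall>j\<in>snd \<kappa>. g (Inl b) \<bullet> f (fst \<kappa>) j = \<beta> (Inl b)}" for \<kappa>
  have fin\<C>: "finite \<C>" by (simp add: \<C>_def)
  have cls_in: "cls a \<in> \<C>" if "a \<in> A" for a
    using cw[OF that] by (auto simp: cls_def \<C>_def)
  have dist_iff: "dist a b = 1 \<longleftrightarrow> b \<in> Yc (cls a)" if a: "a \<in> A" and b: "b \<in> B - Bc (cls a)" for a b
  proof -
    have "dist a b = 1 \<longleftrightarrow> (dist a b)\<^sup>2 = 1" 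
      using power2_eq_iff_nonneg[of "dist a b" 1] by simp
    also have "\<dots> \<longleftrightarrow> g (Inl b) \<bullet> lift a = \<beta> (Inl b)" using g_lift[of b a] by auto
    also have "\<dots> \<longleftrightarrow> (\<forall>y\<in>f (cell a) ` {..k}. w a y > 0 \<longrightarrow> g (Inl b) \<bullet> y = \<beta> (Inl b))"
      using cw[OF a] b by (intro tight_convex_combination) (auto simp: Bc_def cls_def not_less)
    also have "\<dots> \<longleftrightarrow> b \<in> Yc (cls a)" using b by (auto simp: Yc_def cls_def)
    finally show ?thesis .
  qed
  have "real (card (Bc \<kappa>)) \<le> real (k + 1) * (card B / r)" if \<kappa>: "\<kappa> \<in> \<C>" for \<kappa>
  proof -
    define X where "X j = {b \<in> B. \<beta> (Inl b) < g (Inl b) \<bullet> f (fst \<kappa>) j}" for j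
    have "{b \<in> B'. \<beta> b < g b \<bullet> f (fst \<kappa>) j} = Inl ` X j" for j by (auto simp: X_def B'_def)
    then have "real (card (X j)) \<le> card B / r" if "j \<le> k" for j
      using f(1)[of "fst \<kappa>" j] \<kappa> that by (auto simp: \<C>_def card_image)
    then have "(\<Sum>j\<le>k. real (card (X j))) \<le> real (card {..k}) * (card B / r)"
      by (intro sum_bounded_above) auto
    moreover have "Bc \<kappa> = (\<Union>j\<in>{..k}. X j)" by (auto simp: Bc_def X_def)
    then have "card (Bc \<kappa>) \<le> (\<Sum>j\<le>k. card (X j))" by (simp add: card_UN_le)
    then have "real (card (Bc \<kappa>)) \<le> (\<Sum>j\<le>k. real (card (X j)))" by (metis of_nat_le_iff of_nat_sum)
    ultimately show ?thesis by simp
  qed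
  moreover have "(\<Sum>\<kappa>\<in>\<C>. card (Ac \<kappa>)) = card A"
  proof -
    have "(\<Union>\<kappa>\<in>\<C>. Ac \<kappa>) = A" using cls_in by (auto simp: Ac_def)
    moreover have "card (\<Union>\<kappa>\<in>\<C>. Ac \<kappa>) = (\<Sum>\<kappa>\<in>\<C>. card (Ac \<kappa>))"
      by (rule card_UN_disjoint[OF fin\<C>]) (use fin(1) in \<open>auto simp: Ac_def\<close>)
    ultimately show ?thesis by simp
  qed
  moreover have "card (unit_dist_edges A B) \<le>
      (\<Sum>\<kappa>\<in>\<C>. card (unit_dist_edges (Ac \<kappa>) (Bc \<kappa>))) + card \<C> * (u * (card A + card B))"
  proof -
    have finc: "finite (Ac \<kappa>)" "finite (Bc \<kappa>)" "finite (Yc \<kappa>)" for \<kappa>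
      using fin by (auto simp: Ac_def Bc_def Yc_def)
    have finU: "finite (unit_dist_edges (Ac \<kappa>) (Bc \<kappa>) \<union> Ac \<kappa> \<times> Yc \<kappa>)" for \<kappa>
      using finite_unit_dist_edges(1)[OF finc(1,2)] finc(1,3) by (intro finite_UnI finite_cartesian_product)
    have bip: "card (Ac \<kappa> \<times> Yc \<kappa>) \<le> u * (card A + card B)" for \<kappa>
    proof -
      have sub: "Ac \<kappa> \<subseteq> A" "Yc \<kappa> \<subseteq> B" by (auto simp: Ac_def Yc_def)
      have "dist a b = 1" if "a \<in> Ac \<kappa>" "b \<in> Yc \<kappa>" for a b
        using dist_iff[of a b] that by (auto simp: Ac_def Yc_def)
      then have "card (Ac \<kappa>) * card (Yc \<kappa>) \<le> u * (card (Ac \<kappa>) + card (Yc \<kappa>))"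
        by (intro complete_bipartite_le[OF free sub finc(1,3)])
      also have "\<dots> \<le> u * (card A + card B)"
        using sub fin by (intro mult_left_mono add_mono card_mono) auto
      finally show ?thesis by (simp add: card_cartesian_product)
    qed
    have "unit_dist_edges A B \<subseteq> (\<Union>\<kappa>\<in>\<C>. unit_dist_edges (Ac \<kappa>) (Bc \<kappa>) \<union> Ac \<kappa> \<times> Yc \<kappa>)"
    proof
      fix e assume "e \<in> unit_dist_edges A B"
      then obtain a b where e: "e = (a, b)" "a \<in> A" "b \<in> B" "dist a b = 1"
        by (auto simp: unit_dist_edges_def)
      then have "b \<in> Bc (cls a) \<or> b \<in> Yc (cls a)" using dist_iff[of a b] by blast
      then have "e \<in> unit_dist_edges (Ac (cls a)) (Bc (cls a)) \<union> Ac (cls a) \<times> Yc (cls a)"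
        using e by (auto simp: unit_dist_edges_def Ac_def)
      then show "e \<in> (\<Union>\<kappa>\<in>\<C>. unit_dist_edges (Ac \<kappa>) (Bc \<kappa>) \<union> Ac \<kappa> \<times> Yc \<kappa>)"
        using cls_in[OF e(2)] by blast
    qed
    then have "card (unit_dist_edges A B) \<le> card (\<Union>\<kappa>\<in>\<C>. unit_dist_edges (Ac \<kappa>) (Bc \<kappa>) \<union> Ac \<kappa> \<times> Yc \<kappa>)"
      using fin\<C> finU by (intro card_mono finite_UN_I)
    also have "\<dots> \<le> (\<Sum>\<kappa>\<in>\<C>. card (unit_dist_edges (Ac \<kappa>) (Bc \<kappa>) \<union> Ac \<kappa> \<times> Yc \<kappa>))"
      by (rule card_UN_le[OF fin\<C>])
    also have "\<dots> \<le> (\<Sum>\<kappa>\<in>\<C>. card (unit_dist_edges (Ac \<kappa>) (Bc \<kappa>)) + u * (card A + card B))"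
      by (intro sum_mono order_trans[OF card_Un_le] add_left_mono bip)
    finally show ?thesis by (simp add: sum.distrib)
  qed
  moreover have "Ac \<kappa> \<subseteq> A" "Bc \<kappa> \<subseteq> B" for \<kappa> by (auto simp: Ac_def Bc_def)
  ultimately show ?thesis by (intro exI[of _ Ac] exI[of _ Bc]) simp
qed

section \<open>The recursion\<close>

text \<open>Jensen's inequality for t^a, obtained from the tangent line at the mean \<mu>.\<close>

lemma sum_powr_le_concave:
  fixes x :: "'c \<Rightarrow> real"
  assumes "finite S" "\<And>k. k \<in> S \<Longrightarrow> 0 \<le> x k" "0 < a" "a \<le> 1"
  shows "(\<Sum>k\<in>S. x k powr a) \<le> real (card S) powr (1 - a) * (\<Sum>k\<in>S. x k) powr a"
proof (cases "(\<Sum>k\<in>S. x k) = 0")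
  case True
  then have "\<forall>k\<in>S. x k = 0" using sum_nonneg_eq_0_iff[of S x] assms by blast
  then show ?thesis by simp
next
  case False
  let ?t = "\<Sum>k\<in>S. x k"
  have "?t > 0" using False sum_nonneg[of S x] assms(2) by fastforce
  have "card S > 0" using False assms(1) by (cases "S = {}") (auto simp: card_gt_0_iff)
  define \<mu> where "\<mu> = ?t / card S"
  have "\<mu> > 0" using \<open>?t > 0\<close> \<open>card S > 0\<close> by (simp add: \<mu>_def)
  \<comment> \<open>Weighted arithmetic-geometric mean of \<open>y\<close> and 1; it is applied to
    the ratios \<open>x k / \<mu>\<close>.\<close>
  have bern: "y powr a \<le> a * y + (1 - a)" if "y \<ge> 0" for y
    using Youngs_inequality_0[of a "1 - a" y 1] assms(3,4) that by (cases "y = 0") auto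
  have "(\<Sum>k\<in>S. x k powr a) = (\<Sum>k\<in>S. \<mu> powr a * (x k / \<mu>) powr a)"
    using \<open>\<mu> > 0\<close> assms(2) by (intro sum.cong) (auto simp flip: powr_mult)
  also have "\<dots> \<le> (\<Sum>k\<in>S. \<mu> powr a * (a * (x k / \<mu>) + (1 - a)))"
    using \<open>\<mu> > 0\<close> assms(2) by (intro sum_mono mult_left_mono bern) auto
  also have "\<dots> = \<mu> powr a * (a * (?t / \<mu>) + card S * (1 - a))"
    by (simp only: sum.distrib sum_distrib_left[symmetric] sum_divide_distrib[symmetric] sum_constant)
  also have "?t / \<mu> = card S" using \<open>?t > 0\<close> by (simp add: \<mu>_def)
  also have "\<mu> powr a * (a * card S + card S * (1 - a)) = \<mu> powr a * card S" by (simp add: algebra_simps)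
  also have "\<dots> = ?t powr a * (card S powr 1 / card S powr a)"
    using \<open>?t > 0\<close> by (simp add: \<mu>_def powr_divide)
  also have "\<dots> = card S powr (1 - a) * ?t powr a" by (simp add: powr_diff)
  finally show ?thesis .
qed

text \<open>The loss is collected in one common factor \<open>(m * n) powr \<epsilon>\<close>, so
  that a cutting step gains \<open>r powr (- \<epsilon>)\<close> on every term, including the linear
  ones.\<close>

definition incidence_bound :: "real \<Rightarrow> real \<Rightarrow> real \<Rightarrow> real \<Rightarrow> real \<Rightarrow> real" where
  "incidence_bound s \<epsilon> u m n =
     (m * n) powr \<epsilon> * (u powr (2 / (s + 1)) * (m * n) powr (s / (s + 1)) + u * m + u * n)"

text \<open>The hypothesis bounds \<open>r\<close> by (n / u)^(1 / (s + 1)). Inserting this turns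
  the left side into u^(2 / (s + 1)) n^(2 s / (s + 1)), where n * n is at most m * n. This balance
  matches the exponent of \<open>u\<close> in the main term.\<close>

lemma linear_term_le_main_term:
  fixes s u m n r :: real
  assumes "s \<ge> 1" "u > 0" "n \<le> m" "r > 0" "r powr (s + 1) * u \<le> n"
  shows "u * n * r powr (s - 1) \<le> u powr (2 / (s + 1)) * (m * n) powr (s / (s + 1))"
proof -
  have "0 < r powr (s + 1) * u" using assms(2,4) by simp
  then have "n > 0" using assms(5) by linarith
  have "s + 1 \<noteq> 0" using assms(1) by simp
  then have e1: "2 / (s + 1) + (s - 1) / (s + 1) = 1"
    unfolding add_divide_distrib[symmetric] by simp
  have e2: "1 + (s - 1) / (s + 1) = 2 * (s / (s + 1))"
    using \<open>s + 1 \<noteq> 0\<close> by (simp add: divide_simps)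
  have "u * n * r powr (s - 1) = u powr (2 / (s + 1) + (s - 1) / (s + 1)) * n * (r powr (s + 1)) powr ((s - 1) / (s + 1))"
    unfolding e1 powr_powr using assms(1,2) by simp
  also have "\<dots> = u powr (2 / (s + 1)) * (n * (r powr (s + 1) * u) powr ((s - 1) / (s + 1)))"
    using assms by (simp add: powr_add powr_mult)
  also have "\<dots> \<le> u powr (2 / (s + 1)) * (n * n powr ((s - 1) / (s + 1)))"
    using assms \<open>n > 0\<close> by (intro mult_left_mono powr_mono2) auto
  also have "n * n powr ((s - 1) / (s + 1)) = n powr (1 + (s - 1) / (s + 1))"
    using \<open>n > 0\<close> by (simp add: powr_add)
  also have "\<dots> = (n * n) powr (s / (s + 1))"
    unfolding e2 using \<open>n > 0\<close> by (simp add: powr_mult flip: powr_add)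
  also have "u powr (2 / (s + 1)) * (n * n) powr (s / (s + 1)) \<le> u powr (2 / (s + 1)) * (m * n) powr (s / (s + 1))"
    using assms \<open>n > 0\<close> by (intro mult_left_mono powr_mono2) auto
  finally show ?thesis .
qed

text \<open>One cutting step shrinks the bound: \<open>r powr (s + \<epsilon>)\<close> cells of concave size \<open>s / (s + 1)\<close> gain a power of
  \<open>r\<close>, and the term linear in \<open>n\<close>, which would grow, is dominated by the main term.\<close>

lemma incidence_bound_recursion:
  fixes x y :: "'c \<Rightarrow> real"
  assumes "finite S" and card: "real (card S) \<le> r powr (s + \<epsilon>) / 4"
    and "s \<ge> 1" "\<epsilon> > 0" "u > 0" "r \<ge> 1" and r: "r powr (\<epsilon> / 2) \<ge> 4"
    and "n \<le> m" "r powr (s + 1) * u \<le> n"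
    and x: "\<And>k. k \<in> S \<Longrightarrow> 0 \<le> x k" "(\<Sum>k\<in>S. x k) = m"
    and y: "\<And>k. k \<in> S \<Longrightarrow> 0 \<le> y k" "\<And>k. k \<in> S \<Longrightarrow> y k \<le> n / r"
  shows "(\<Sum>k\<in>S. incidence_bound s \<epsilon> u (x k) (y k)) \<le> incidence_bound s \<epsilon> u m n / 2"
proof -
  define a where "a = s / (s + 1)"
  have a: "0 < a" "a \<le> 1" "1 - a = 1 / (s + 1)" using \<open>s \<ge> 1\<close> by (auto simp: a_def field_simps)
  define U where "U = u powr (2 / (s + 1))"
  define W where "W = (m * n) powr \<epsilon>"
  define w where "w = r powr (- \<epsilon>)"
  define T where "T = U * (m * n) powr a"
  have "r powr (s + 1) * u > 0" using \<open>u > 0\<close> \<open>r \<ge> 1\<close> by simp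
  then have mn: "n > 0" "m > 0" using assms(8,9) by linarith+
  have nonneg: "0 \<le> U" "0 \<le> W" "0 \<le> w" "0 \<le> T" by (simp_all add: U_def W_def w_def T_def)
  have cell_le: "incidence_bound s \<epsilon> u (x k) (y k) \<le> W * w * (U * (n / r) powr a * x k powr a + u * x k + u * (n / r))"
    if k: "k \<in> S" for k
  proof -
    have xm: "x k \<le> m"
      unfolding x(2)[symmetric] by (rule member_le_sum[OF k]) (use x(1) \<open>finite S\<close> in auto)
    have "x k * y k \<le> m * (n / r)" using xm x(1)[OF k] y[OF k] mn by (intro mult_mono) auto
    then have "(x k * y k) powr \<epsilon> \<le> (m * n / r) powr \<epsilon>"
      using x(1)[OF k] y(1)[OF k] \<open>\<epsilon> > 0\<close> by (intro powr_mono2) auto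
    also have "\<dots> = W * w" using mn \<open>r \<ge> 1\<close> by (simp add: W_def w_def powr_divide powr_minus_divide)
    finally have 1: "(x k * y k) powr \<epsilon> \<le> W * w" .
    have "(x k * y k) powr a \<le> (x k * (n / r)) powr a"
      using x(1)[OF k] y[OF k] a by (intro powr_mono2 mult_left_mono) auto
    also have "\<dots> = (n / r) powr a * x k powr a"
      using x(1)[OF k] mn \<open>r \<ge> 1\<close> by (subst powr_mult) auto
    finally have "U * (x k * y k) powr a + u * x k + u * y k
        \<le> U * ((n / r) powr a * x k powr a) + u * x k + u * (n / r)"
      using nonneg \<open>u > 0\<close> y(2)[OF k] by (intro add_mono mult_left_mono) auto
    then show ?thesis
      unfolding incidence_bound_def U_def[symmetric] a_def[symmetric]
      using 1 nonneg \<open>u > 0\<close> x(1)[OF k] y(1)[OF k] mult_mono[OF 1] by (simp add: mult.assoc)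
  qed
  have wr: "w \<le> 1 / 4"
  proof -
    have "w \<le> r powr (- (\<epsilon> / 2))" unfolding w_def using \<open>r \<ge> 1\<close> \<open>\<epsilon> > 0\<close> by (intro powr_mono) auto
    also have "\<dots> \<le> 1 / 4" using r by (simp add: powr_minus divide_simps)
    finally show ?thesis .
  qed
  \<comment> \<open>Since \<open>s * (1 - a) = a\<close>, the powers of \<open>r\<close> combine to
    \<open>r powr (- (\<epsilon> * a))\<close>. As \<open>a\<close> is at least 1/2, this is at most
    \<open>r powr (- (\<epsilon> / 2))\<close>, hence at most 1/4.\<close>
  have main: "w * (U * (n / r) powr a * (card S powr (1 - a) * m powr a)) \<le> T / 4"
  proof -
    have "real (card S) powr (1 - a) \<le> (r powr (s + \<epsilon>)) powr (1 - a)"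
      using card a(2) by (intro powr_mono2) linarith+
    then have "w * r powr (- a) * real (card S) powr (1 - a) \<le> w * r powr (- a) * (r powr (s + \<epsilon>)) powr (1 - a)"
      using nonneg by (intro mult_left_mono) auto
    also have "\<dots> = r powr (- \<epsilon> - a + (s + \<epsilon>) * (1 - a))"
      by (simp add: w_def powr_powr powr_add[symmetric])
    also have "- \<epsilon> - a + (s + \<epsilon>) * (1 - a) = - (\<epsilon> * a)"
    proof -
      have "s * (1 - a) = a" unfolding a(3) by (simp add: a_def)
      then show ?thesis by (simp add: algebra_simps)
    qed
    also have "r powr (- (\<epsilon> * a)) \<le> r powr (- (\<epsilon> / 2))"
    proof (rule powr_mono[OF _ \<open>r \<ge> 1\<close>])
      have "1 / 2 \<le> a" using \<open>s \<ge> 1\<close> by (simp add: a_def field_simps)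
      then show "- (\<epsilon> * a) \<le> - (\<epsilon> / 2)" using \<open>\<epsilon> > 0\<close> by (simp add: field_simps)
    qed
    also have "\<dots> \<le> 1 / 4" using r by (simp add: powr_minus divide_simps)
    finally have "T * (w * r powr (- a) * real (card S) powr (1 - a)) \<le> T * (1 / 4)"
      using nonneg by (intro mult_left_mono)
    moreover have "w * (U * (n / r) powr a * (card S powr (1 - a) * m powr a)) =
        T * (w * r powr (- a) * real (card S) powr (1 - a))"
      using mn \<open>r \<ge> 1\<close> by (simp add: T_def powr_mult powr_divide powr_minus_divide)
    ultimately show ?thesis by linarith
  qed
  \<comment> \<open>Every cell may contribute \<open>u * (n / r)\<close>, because the sets
    \<open>Bc\<close> of different cells overlap. The factor \<open>w\<close> cancels the \<epsilon>
    in the number of cells and leaves \<open>r powr (s - 1)\<close>.\<close>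
  have linear: "w * (card S * (u * (n / r))) \<le> T / 4"
  proof -
    have "w * (card S / r) \<le> w * (r powr (s + \<epsilon>) / 4 / r)"
      using card nonneg \<open>r \<ge> 1\<close> by (intro mult_left_mono divide_right_mono) auto
    also have "\<dots> = (r powr (- \<epsilon>) * r powr (s + \<epsilon>) * r powr (- 1)) / 4"
    proof -
      have "r powr (- 1) = 1 / r" using \<open>r \<ge> 1\<close> by (simp add: powr_minus_divide)
      then show ?thesis by (simp only: w_def times_divide_eq_right times_divide_eq_left mult_1_right
            divide_divide_eq_left mult.commute[of 4 r])
    qed
    also have "r powr (- \<epsilon>) * r powr (s + \<epsilon>) * r powr (- 1) = r powr (s - 1)"
      by (simp only: powr_add[symmetric]) simp
    finally have "w * (card S / r) \<le> r powr (s - 1) / 4" .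
    then have "w * (card S / r) * (u * n) \<le> r powr (s - 1) / 4 * (u * n)"
      using \<open>u > 0\<close> mn by (intro mult_right_mono) auto
    moreover have "u * n * r powr (s - 1) \<le> T"
      unfolding T_def U_def a_def using assms by (intro linear_term_le_main_term) auto
    ultimately show ?thesis by (simp add: mult_ac)
  qed
  have "(\<Sum>k\<in>S. incidence_bound s \<epsilon> u (x k) (y k))
      \<le> (\<Sum>k\<in>S. W * w * (U * (n / r) powr a * x k powr a + u * x k + u * (n / r)))"
    by (rule sum_mono[OF cell_le])
  also have "\<dots> = W * w * (U * (n / r) powr a * (\<Sum>k\<in>S. x k powr a) + u * m + card S * (u * (n / r)))"
    by (simp only: sum_distrib_left[symmetric] sum.distrib sum_constant x(2)) (simp only: mult.left_commute)
  also have "\<dots> = W * (w * (U * (n / r) powr a * (\<Sum>k\<in>S. x k powr a)) + w * (u * m) + w * (card S * (u * (n / r))))"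
    by (simp only: distrib_left mult.assoc)
  also have "\<dots> \<le> W * (w * (U * (n / r) powr a * (card S powr (1 - a) * m powr a)) + w * (u * m) + w * (card S * (u * (n / r))))"
    using sum_powr_le_concave[OF \<open>finite S\<close> x(1) a(1,2)] x(2) nonneg
    by (intro mult_left_mono add_right_mono) auto
  also have "\<dots> \<le> W * (T / 4 + 1 / 4 * (u * m) + T / 4)"
    using main linear wr nonneg \<open>u > 0\<close> mn by (intro mult_left_mono add_mono mult_right_mono) auto
  also have "\<dots> \<le> W * ((T + u * m + u * n) / 2)"
    using nonneg \<open>u > 0\<close> mn by (intro mult_left_mono) (auto simp: field_simps)
  also have "\<dots> = incidence_bound s \<epsilon> u m n / 2"
    by (simp add: incidence_bound_def W_def T_def U_def a_def)
  finally show ?thesis .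
qed

text \<open>A sample of size about r^(1 + \<eta>) suffices: the failure bound is a power of
  \<open>r\<close> times exp(- q r^\<eta>) and tends to 0. The number of cells is of order r^((1 +
  \<eta>) s) = r^(s + \<epsilon> / 2), and the remaining r^(\<epsilon> / 2) absorbs all constants.
  The factor \<open>2 ^ (k + 1)\<close> counts the vertex subsets of a simplex.\<close>

lemma cutting_parameters:
  fixes k :: nat and \<epsilon> R :: real
  assumes "k \<ge> 2" "\<epsilon> > 0"
  shows "\<exists>r\<ge>R. r \<ge> 1 \<and> (\<exists>\<rho>::nat.
    real ((k + 1) * (\<rho> + 1) ^ k) * (real (2 ^ (2 * k + k)) * (1 - 1 / (real (k + 1) * r)) ^ (\<rho> - k)) < 1 \<and>
    real (2 * ((k div 2 + 1) * (2 * k + \<rho> + 1) ^ (k div 2)) * ((k + 1) * (k + 1) ^ k) * 2 ^ (k + 1))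
      \<le> r powr (real (k div 2) + \<epsilon>) / 4)"
proof -
  define s where "s = k div 2"
  have "s \<ge> 1" using \<open>k \<ge> 2\<close> by (simp add: s_def)
  define \<eta> where "\<eta> = \<epsilon> / (2 * s)"
  have "\<eta> > 0" using \<open>s \<ge> 1\<close> \<open>\<epsilon> > 0\<close> by (simp add: \<eta>_def)
  \<comment> \<open>The 3 comes from \<open>\<rho> + 1 \<le> 3 * p\<close>, and the factor
    \<open>2 ^ s\<close> in \<open>K2\<close> from \<open>2 * k + \<rho> + 1 \<le> 2 * p\<close>,
    where \<open>p = r powr (1 + \<eta>)\<close>.\<close>
  define K1 where "K1 = real (k + 1) * 3 ^ k * 2 ^ (2 * k + k)"
  define K2 where "K2 = real (2 * (s + 1)) * 2 ^ s * real ((k + 1) * (k + 1) ^ k * 2 ^ (k + 1))"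
  \<comment> \<open>Half of \<open>1 / (k + 1)\<close>, because \<open>\<rho> - k\<close> is only
    known to be at least \<open>p / 2\<close>.\<close>
  define q where "q = 1 / (2 * real (k + 1))"
  have "q > 0" by (simp add: q_def)
  have ev1: "\<forall>\<^sub>F r in at_top. K1 * r powr ((1 + \<eta>) * k) * exp (- (q * r powr \<eta>)) < 1"
  proof (rule order_tendstoD(2))
    show "((\<lambda>r. K1 * r powr ((1 + \<eta>) * k) * exp (- (q * r powr \<eta>))) \<longlongrightarrow> 0) at_top"
      using \<open>q > 0\<close> \<open>\<eta> > 0\<close> by real_asymp
  qed simp
  have ev2: "\<forall>\<^sub>F r in at_top. r powr (\<epsilon> / 2) \<ge> 4 * K2"
    using \<open>\<epsilon> > 0\<close> by real_asymp
  have ev3: "\<forall>\<^sub>F r::real in at_top. r powr (1 + \<eta>) \<ge> 2 * real k + 2"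
    using \<open>\<eta> > 0\<close> by real_asymp
  have "\<forall>\<^sub>F r::real in at_top. r \<ge> R \<and> r \<ge> 1"
    using eventually_ge_at_top[of R] eventually_ge_at_top[of 1] by eventually_elim simp
  with ev1 ev2 ev3 have "\<forall>\<^sub>F r in at_top. K1 * r powr ((1 + \<eta>) * k) * exp (- (q * r powr \<eta>)) < 1 \<and>
      r powr (\<epsilon> / 2) \<ge> 4 * K2 \<and> r powr (1 + \<eta>) \<ge> 2 * real k + 2 \<and> r \<ge> R \<and> r \<ge> 1"
    by eventually_elim simp
  then obtain r where r: "K1 * r powr ((1 + \<eta>) * k) * exp (- (q * r powr \<eta>)) < 1"
      "r powr (\<epsilon> / 2) \<ge> 4 * K2" "r powr (1 + \<eta>) \<ge> 2 * real k + 2" "r \<ge> R" "r \<ge> 1"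
    using eventually_happens'[OF trivial_limit_at_top_linorder] by blast
  define p where "p = r powr (1 + \<eta>)"
  define \<rho> where "\<rho> = nat \<lceil>p\<rceil>"
  have p: "p \<ge> 2 * real k + 2" using r(3) by (simp add: p_def)
  have \<rho>: "p \<le> real \<rho>" "real \<rho> \<le> p + 1" using p by (auto simp: \<rho>_def of_nat_nat)
  let ?x = "1 / (real (k + 1) * r)"
  have x: "0 < ?x" "?x \<le> 1" using r(5) by (auto simp: divide_simps mult_ge1_I)
  have exp_le: "(1 - ?x) ^ (\<rho> - k) \<le> exp (- (q * r powr \<eta>))"
  proof -
    have "(1 - ?x) ^ (\<rho> - k) \<le> exp (- ?x) ^ (\<rho> - k)"
      using x exp_ge_add_one_self[of "- ?x"] by (intro power_mono) auto
    also have "\<dots> = exp (- (real (\<rho> - k) * ?x))" by (simp flip: exp_of_nat_mult)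
    also have "q * r powr \<eta> \<le> real (\<rho> - k) * ?x"
    proof -
      have "r powr \<eta> = p / r" using r(5) by (simp add: p_def powr_add)
      then have "q * r powr \<eta> = (p / 2) * ?x" by (simp add: q_def)
      also have "\<dots> \<le> real (\<rho> - k) * ?x"
        using p \<rho> x(1) by (intro mult_right_mono) (auto simp: of_nat_diff)
      finally show ?thesis .
    qed
    then have "exp (- (real (\<rho> - k) * ?x)) \<le> exp (- (q * r powr \<eta>))" by simp
    finally show ?thesis .
  qed
  have "real ((k + 1) * (\<rho> + 1) ^ k) * (real (2 ^ (2 * k + k)) * (1 - ?x) ^ (\<rho> - k))
      \<le> real (k + 1) * (3 * p) ^ k * (2 ^ (2 * k + k) * exp (- (q * r powr \<eta>)))"
  proof (rule mult_mono)
    have "real (\<rho> + 1) ^ k \<le> (3 * p) ^ k" using p \<rho> by (intro power_mono) auto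
    then show "real ((k + 1) * (\<rho> + 1) ^ k) \<le> real (k + 1) * (3 * p) ^ k"
      unfolding of_nat_mult of_nat_power by (intro mult_left_mono) auto
    show "real (2 ^ (2 * k + k)) * (1 - ?x) ^ (\<rho> - k) \<le> 2 ^ (2 * k + k) * exp (- (q * r powr \<eta>))"
      using exp_le by simp
  qed (use p x in auto)
  also have "\<dots> = K1 * r powr ((1 + \<eta>) * k) * exp (- (q * r powr \<eta>))"
    using r(5) by (simp add: K1_def p_def power_mult_distrib powr_powr flip: powr_realpow)
  also have "\<dots> < 1" by (rule r(1))
  finally have small: "real ((k + 1) * (\<rho> + 1) ^ k) * (real (2 ^ (2 * k + k)) * (1 - ?x) ^ (\<rho> - k)) < 1" .
  have "real (2 * ((s + 1) * (2 * k + \<rho> + 1) ^ s) * ((k + 1) * (k + 1) ^ k) * 2 ^ (k + 1))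
      = real (2 * (s + 1)) * real (2 * k + \<rho> + 1) ^ s * real ((k + 1) * (k + 1) ^ k * 2 ^ (k + 1))"
    by (simp only: of_nat_mult of_nat_power mult_ac)
  also have "\<dots> \<le> real (2 * (s + 1)) * (2 * p) ^ s * real ((k + 1) * (k + 1) ^ k * 2 ^ (k + 1))"
    using p \<rho> by (intro mult_right_mono mult_left_mono power_mono) auto
  also have "\<dots> = K2 * p ^ s" by (simp add: K2_def power_mult_distrib)
  also have "p ^ s = r powr (s + \<epsilon> / 2)"
  proof -
    have "(1 + \<eta>) * s = s + \<epsilon> / 2" using \<open>s \<ge> 1\<close> by (simp add: \<eta>_def field_simps)
    then show ?thesis using r(5) by (simp add: p_def powr_powr flip: powr_realpow)
  qed
  also have "K2 * r powr (s + \<epsilon> / 2) \<le> r powr (\<epsilon> / 2) / 4 * r powr (s + \<epsilon> / 2)"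
    using r(2) by (intro mult_right_mono) auto
  also have "\<dots> = r powr (s + \<epsilon>) / 4" by (simp add: add.commute flip: powr_add)
  finally have "real (2 * ((s + 1) * (2 * k + \<rho> + 1) ^ s) * ((k + 1) * (k + 1) ^ k) * 2 ^ (k + 1))
      \<le> r powr (s + \<epsilon>) / 4" .
  with small r(4,5) show ?thesis unfolding s_def by blast
qed

text \<open>What one cutting step delivers. The parameters \<open>r\<close> and \<open>M\<close> are
  kept explicit so that they can be fixed before the sets and reused at every level of the
  recursion.\<close>

definition splits_into :: "real \<Rightarrow> nat \<Rightarrow> nat \<Rightarrow> 'a::euclidean_space set \<Rightarrow> 'a set \<Rightarrow> bool" where
  "splits_into r M u A B \<longleftrightarrow> (\<exists>(S::(nat \<times> nat set) set) Ac Bc. finite S \<and> card S = M \<and>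
         (\<forall>\<kappa>\<in>S. Ac \<kappa> \<subseteq> A \<and> Bc \<kappa> \<subseteq> B \<and> real (card (Bc \<kappa>)) \<le> card B / r) \<and>
         (\<Sum>\<kappa>\<in>S. card (Ac \<kappa>)) = card A \<and>
         card (unit_dist_edges A B) \<le>
           (\<Sum>\<kappa>\<in>S. card (unit_dist_edges (Ac \<kappa>) (Bc \<kappa>))) + M * (u * (card A + card B)))"

lemma unit_distance_reduction:
  fixes \<epsilon> R :: real
  assumes "\<epsilon> > 0"
  shows "\<exists>r\<ge>R. r \<ge> 1 \<and> (\<exists>M::nat. real M \<le> r powr (real ((DIM('a) + 1) div 2) + \<epsilon>) / 4 \<and>
    (\<forall>(A::'a::euclidean_space set) B u. finite A \<longrightarrow> finite B \<longrightarrow> A \<noteq> {} \<longrightarrow> B \<noteq> {} \<longrightarrow>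
       (\<forall>a\<in>A. \<forall>b\<in>B. dist a b \<le> 1) \<longrightarrow> Kuu_free u A B \<longrightarrow>
       splits_into r M u A B))"
proof -
  define k where "k = DIM('a \<times> real)"
  have k: "k = DIM('a) + 1" by (simp add: k_def)
  have "k \<ge> 2" unfolding k using DIM_positive[where 'a='a] by linarith
  define N where "N \<rho> = 2 * ((k div 2 + 1) * (2 * k + \<rho> + 1) ^ (k div 2)) * ((k + 1) * (k + 1) ^ k)" for \<rho>
  obtain r \<rho> where r: "r \<ge> R" "r \<ge> 1"
    and small: "real ((k + 1) * (\<rho> + 1) ^ k) * (real (2 ^ (2 * k + k)) * (1 - 1 / (real (k + 1) * r)) ^ (\<rho> - k)) < 1"
    and N: "real (N \<rho> * 2 ^ (k + 1)) \<le> r powr (real (k div 2) + \<epsilon>) / 4"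
    using cutting_parameters[OF \<open>k \<ge> 2\<close> assms, of R] unfolding N_def by blast
  show ?thesis
  proof (intro exI[of _ r] exI[of _ "N \<rho> * 2 ^ (k + 1)"] conjI allI impI)
    show "r \<ge> R" "r \<ge> 1" by (fact r)+
    show "real (N \<rho> * 2 ^ (k + 1)) \<le> r powr (real ((DIM('a) + 1) div 2) + \<epsilon>) / 4"
      using N unfolding k .
  next
    fix A B :: "'a set" and u
    assume AB: "finite A" "finite B" "A \<noteq> {}" "B \<noteq> {}" "\<forall>a\<in>A. \<forall>b\<in>B. dist a b \<le> 1" "Kuu_free u A B"
    define S where "S = {..<N \<rho>} \<times> Pow {..k}"
    have S: "finite S" "card S = N \<rho> * 2 ^ (k + 1)"
      by (simp_all add: S_def card_cartesian_product card_Pow)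
    \<comment> \<open>Cutting with \<open>real (k + 1) * r\<close> compensates for the factor
      \<open>k + 1\<close> lost when the conflicts of all vertices of a simplex are united.\<close>
    have "real (k + 1) * r \<ge> 1" using r(2) mult_mono[of 1 "real (k + 1)" 1 r] by simp
    then obtain Ac Bc where *: "\<forall>\<kappa>\<in>S. Ac \<kappa> \<subseteq> A \<and> Bc \<kappa> \<subseteq> B \<and> real (card (Bc \<kappa>)) \<le> real (k + 1) * (card B / (real (k + 1) * r))"
        "(\<Sum>\<kappa>\<in>S. card (Ac \<kappa>)) = card A"
        "card (unit_dist_edges A B) \<le> (\<Sum>\<kappa>\<in>S. card (unit_dist_edges (Ac \<kappa>) (Bc \<kappa>))) + card S * (u * (card A + card B))"
      using unit_distance_decomposition[OF AB(1-4) _ AB(6), of "real (k + 1) * r" \<rho> "N \<rho>"] AB(5) small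
      unfolding N_def S_def k_def by blast
    have "real (k + 1) * (card B / (real (k + 1) * r)) = card B / r" by simp
    with * S show "splits_into r (N \<rho> * 2 ^ (k + 1)) u A B"
      unfolding splits_into_def
      by (intro exI[of _ S] exI[of _ Ac] exI[of _ Bc]) simp
  qed
qed

section \<open>The induction over both point classes\<close>

lemma incidence_bound_commute: "incidence_bound s \<epsilon> u m n = incidence_bound s \<epsilon> u n m"
  by (simp add: incidence_bound_def mult.commute add_ac)

lemma incidence_bound_nonneg: "u \<ge> 0 \<Longrightarrow> m \<ge> 0 \<Longrightarrow> n \<ge> 0 \<Longrightarrow> 0 \<le> incidence_bound s \<epsilon> u m n"
  by (simp add: incidence_bound_def)

lemma linear_terms_le_incidence_bound:
  assumes "u \<ge> 0" "m \<ge> 1" "n \<ge> 1" "\<epsilon> > 0"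
  shows "u * m + u * n \<le> incidence_bound s \<epsilon> u m n"
proof -
  have "m * n \<ge> 1" using mult_mono[of 1 m 1 n] assms by simp
  then have "(m * n) powr \<epsilon> \<ge> 1" using assms(4) by (simp add: ge_one_powr_ge_zero)
  have "0 \<le> u powr (2 / (s + 1)) * (m * n) powr (s / (s + 1))" by simp
  then have "1 * (u * m + u * n) \<le> (m * n) powr \<epsilon> * (u powr (2 / (s + 1)) * (m * n) powr (s / (s + 1)) + u * m + u * n)"
    using \<open>(m * n) powr \<epsilon> \<ge> 1\<close> assms by (intro mult_mono) auto
  then show ?thesis by (simp add: incidence_bound_def)
qed

text \<open>Induction on the total number of points, with the larger class as points and the smaller
  as halfspaces. If the smaller class has at most \<open>Q * u\<close> elements, the number of pairs
  is within the linear terms. Otherwise the recursion spends half of the bound on the cells, and the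
  other half pays for the complete bipartite pieces.\<close>

lemma unit_distance_bound:
  fixes \<epsilon> :: real
  assumes "\<epsilon> > 0"
  shows "\<exists>C\<ge>0. \<forall>(A::'a::euclidean_space set) B u. finite A \<longrightarrow> finite B \<longrightarrow>
     (\<forall>a\<in>A. \<forall>b\<in>B. dist a b \<le> 1) \<longrightarrow> Kuu_free u A B \<longrightarrow>
     real (card (unit_dist_edges A B)) \<le>
       C * incidence_bound (real ((DIM('a) + 1) div 2)) \<epsilon> u (card A) (card B)"
proof -
  define s where "s = real ((DIM('a) + 1) div 2)"
  have "(DIM('a) + 1) div 2 \<ge> 1" using DIM_positive[where 'a='a] by linarith
  then have s: "s \<ge> 1" by (simp add: s_def)
  \<comment> \<open>The bound 2 makes \<open>Bc\<close> strictly smaller than the set it is taken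
    from, so the induction descends; the bound \<open>4 powr (2 / \<epsilon>)\<close> gives
    \<open>r powr (\<epsilon> / 2) \<ge> 4\<close>.\<close>
  obtain r M where r: "r \<ge> max 2 (4 powr (2 / \<epsilon>))" "r \<ge> 1"
    and M: "real M \<le> r powr (s + \<epsilon>) / 4"
    and cut: "\<And>(A::'a set) B u. finite A \<Longrightarrow> finite B \<Longrightarrow> A \<noteq> {} \<Longrightarrow> B \<noteq> {} \<Longrightarrow>
       \<forall>a\<in>A. \<forall>b\<in>B. dist a b \<le> 1 \<Longrightarrow> Kuu_free u A B \<Longrightarrow> splits_into r M u A B"
    using unit_distance_reduction[OF assms, of "max 2 (4 powr (2 / \<epsilon>))", where 'a='a]
    unfolding s_def[symmetric] by blast
  have r4: "r powr (\<epsilon> / 2) \<ge> 4"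
  proof -
    have "4 = (4 powr (2 / \<epsilon>)) powr (\<epsilon> / 2)" using assms by (simp add: powr_powr)
    also have "\<dots> \<le> r powr (\<epsilon> / 2)" using r(1) assms by (intro powr_mono2) auto
    finally show ?thesis .
  qed
  define Q where "Q = r powr (s + 1)"
  \<comment> \<open>\<open>Q\<close> covers small classes, and \<open>2 * M\<close> makes the error
    \<open>M * u * (m + n)\<close> at most half of the target.\<close>
  define C where "C = Q + 2 * real M"
  have QC: "0 \<le> Q" "Q \<le> C" "2 * real M \<le> C" "0 \<le> C" by (auto simp: Q_def C_def)
  let ?H = "incidence_bound s \<epsilon>"
  have "real (card (unit_dist_edges A B)) \<le> C * ?H u (card A) (card B)"
    if "finite A" "finite B" "\<forall>a\<in>A. \<forall>b\<in>B. dist a b \<le> 1" "Kuu_free u A B" for A B :: "'a set" and u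
    using that
  proof (induction "card A + card B" arbitrary: A B rule: less_induct)
    case less
    have "u > 0" by (rule Kuu_free_pos[OF less.prems(4)])
    \<comment> \<open>Used for \<open>(A, B)\<close> or \<open>(B, A)\<close>, whichever puts the
      smaller set second. The equality of the cardinality sums keeps the induction hypothesis
      available after the exchange.\<close>
    have step: "real (card (unit_dist_edges X Y)) \<le> C * ?H u (card X) (card Y)"
      if XY: "finite X" "finite Y" "\<forall>a\<in>X. \<forall>b\<in>Y. dist a b \<le> 1" "Kuu_free u X Y"
        "card X + card Y = card A + card B" "card Y \<le> card X" for X Y :: "'a set"
    proof (cases "Y = {}")
      case True
      then show ?thesis
        using QC by (simp add: unit_dist_edges_def incidence_bound_nonneg)
    next
      case False
      then have "card Y \<ge> 1" using XY(2) by (simp add: Suc_leI card_gt_0_iff)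
      then have "card X \<ge> 1" using XY(6) by linarith
      then have "X \<noteq> {}" by auto
      have lin: "real u * card X + real u * card Y \<le> ?H u (card X) (card Y)"
        using \<open>card X \<ge> 1\<close> \<open>card Y \<ge> 1\<close> assms by (intro linear_terms_le_incidence_bound) auto
      show ?thesis
      proof (cases "real (card Y) \<le> Q * u")
        case True
        have "real (card (unit_dist_edges X Y)) \<le> real (card X * card Y)"
          using finite_unit_dist_edges(2)[OF XY(1,2)] of_nat_mono by blast
        also have "\<dots> \<le> card X * (Q * u)" using True by (simp add: mult_left_mono)
        also have "\<dots> \<le> Q * (real u * card X + real u * card Y)" using QC(1) by (simp add: algebra_simps)
        also have "\<dots> \<le> C * ?H u (card X) (card Y)" using lin QC by (intro mult_mono) auto
        finally show ?thesis .
      next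
        case False
        obtain S :: "(nat \<times> nat set) set" and Ac Bc where S: "finite S" "card S = M"
          and sub: "\<And>\<kappa>. \<kappa> \<in> S \<Longrightarrow> Ac \<kappa> \<subseteq> X \<and> Bc \<kappa> \<subseteq> Y \<and> real (card (Bc \<kappa>)) \<le> card Y / r"
          and sum: "(\<Sum>\<kappa>\<in>S. card (Ac \<kappa>)) = card X"
          and edges: "card (unit_dist_edges X Y) \<le>
             (\<Sum>\<kappa>\<in>S. card (unit_dist_edges (Ac \<kappa>) (Bc \<kappa>))) + M * (u * (card X + card Y))"
          using cut[OF XY(1,2) \<open>X \<noteq> {}\<close> \<open>Y \<noteq> {}\<close> XY(3,4)] unfolding splits_into_def by blast
        have IH: "real (card (unit_dist_edges (Ac \<kappa>) (Bc \<kappa>))) \<le> C * ?H u (card (Ac \<kappa>)) (card (Bc \<kappa>))"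
          if \<kappa>: "\<kappa> \<in> S" for \<kappa>
        proof (rule less.hyps)
          have "real (card Y) / r < card Y" using \<open>card Y \<ge> 1\<close> r(1) by (simp add: divide_less_eq)
          then have "card (Bc \<kappa>) < card Y" using sub[OF \<kappa>] by linarith
          moreover have "card (Ac \<kappa>) \<le> card X" using sub[OF \<kappa>] XY(1) by (intro card_mono) auto
          ultimately show "card (Ac \<kappa>) + card (Bc \<kappa>) < card A + card B" using XY(5) by linarith
          show "finite (Ac \<kappa>)" "finite (Bc \<kappa>)" using sub[OF \<kappa>] XY(1,2) finite_subset by blast+
          show "\<forall>a\<in>Ac \<kappa>. \<forall>b\<in>Bc \<kappa>. dist a b \<le> 1" using sub[OF \<kappa>] XY(3) by blast
          show "Kuu_free u (Ac \<kappa>) (Bc \<kappa>)" using Kuu_free_subset[OF XY(4)] sub[OF \<kappa>] by blast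
        qed
        have rec: "(\<Sum>\<kappa>\<in>S. ?H u (card (Ac \<kappa>)) (card (Bc \<kappa>))) \<le> ?H u (card X) (card Y) / 2"
        proof (rule incidence_bound_recursion[OF S(1) _ s assms _ r(2) r4])
          show "real (card S) \<le> r powr (s + \<epsilon>) / 4" using M S(2) by simp
          show "(\<Sum>\<kappa>\<in>S. real (card (Ac \<kappa>))) = real (card X)" using sum by (simp flip: of_nat_sum)
          show "r powr (s + 1) * real u \<le> real (card Y)" using False by (simp add: Q_def)
        qed (use \<open>u > 0\<close> XY(6) sub in auto)
        have "real (card (unit_dist_edges X Y)) \<le>
            (\<Sum>\<kappa>\<in>S. real (card (unit_dist_edges (Ac \<kappa>) (Bc \<kappa>)))) + M * (real u * card X + real u * card Y)"
          using of_nat_mono[OF edges, where 'a=real] by (simp add: distrib_left)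
        also have "\<dots> \<le> (\<Sum>\<kappa>\<in>S. C * ?H u (card (Ac \<kappa>)) (card (Bc \<kappa>))) + C / 2 * ?H u (card X) (card Y)"
          using IH lin QC by (intro add_mono sum_mono mult_mono) auto
        also have "\<dots> = C * (\<Sum>\<kappa>\<in>S. ?H u (card (Ac \<kappa>)) (card (Bc \<kappa>))) + C / 2 * ?H u (card X) (card Y)"
          by (simp add: sum_distrib_left)
        also have "\<dots> \<le> C * (?H u (card X) (card Y) / 2) + C / 2 * ?H u (card X) (card Y)"
          using rec QC by (intro add_right_mono mult_left_mono)
        finally show ?thesis by simp
      qed
    qed
    show ?case
    proof (cases "card B \<le> card A")
      case True
      then show ?thesis using less.prems by (intro step) auto
    next
      case False
      have "\<forall>b\<in>B. \<forall>a\<in>A. dist b a \<le> 1" using less.prems(3) dist_commute by metis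
      then have "real (card (unit_dist_edges B A)) \<le> C * ?H u (card B) (card A)"
        using less.prems(1,2) Kuu_free_commute[OF less.prems(4)] False by (intro step) auto
      then show ?thesis
        by (simp add: card_unit_dist_edges_commute[of A B] incidence_bound_commute[of s \<epsilon> u "card A"])
    qed
  qed
  then show ?thesis using QC(4) unfolding s_def by blast
qed

text \<open>With \<open>h\<close> the larger of \<open>m\<close> and \<open>n\<close>, the common
  factor \<open>(m * n) powr (\<epsilon> / 2)\<close> is at most \<open>h powr \<epsilon>\<close>.
  It can thus be charged to the linear term of the larger class alone, which costs the factor
  2.\<close>

lemma incidence_bound_half_le:
  assumes "u \<ge> 0" "m \<ge> 1" "n \<ge> 1" "\<epsilon> > 0"
  shows "incidence_bound s (\<epsilon> / 2) u m n \<le>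
    2 * (u powr (2 / (s + 1)) * (m * n) powr (s / (s + 1) + \<epsilon>) + u * m powr (1 + \<epsilon>) + u * n powr (1 + \<epsilon>))"
proof -
  have "m * n \<ge> 1" using mult_mono[of 1 m 1 n] assms by simp
  have "(m * n) powr (\<epsilon> / 2) * (u powr (2 / (s + 1)) * (m * n) powr (s / (s + 1)))
      = u powr (2 / (s + 1)) * (m * n) powr (s / (s + 1) + \<epsilon> / 2)"
    by (simp add: powr_add mult_ac)
  also have "\<dots> \<le> u powr (2 / (s + 1)) * (m * n) powr (s / (s + 1) + \<epsilon>)"
    using \<open>m * n \<ge> 1\<close> assms by (intro mult_left_mono powr_mono) auto
  finally have 1: "(m * n) powr (\<epsilon> / 2) * (u powr (2 / (s + 1)) * (m * n) powr (s / (s + 1))) \<le> \<dots>" .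
  define h where "h = max m n"
  have h: "h \<ge> 1" "m \<le> h" "n \<le> h" using assms by (auto simp: h_def)
  have "(m * n) powr (\<epsilon> / 2) * (u * m + u * n) \<le> (h * h) powr (\<epsilon> / 2) * (u * h + u * h)"
    using h assms by (intro mult_mono powr_mono2 add_mono mult_left_mono) auto
  also have "(h * h) powr (\<epsilon> / 2) = h powr \<epsilon>"
    using h by (simp add: powr_mult flip: powr_add)
  also have "h powr \<epsilon> * (u * h + u * h) = 2 * (u * h powr (1 + \<epsilon>))"
    using h by (simp add: powr_add)
  also have "\<dots> \<le> 2 * (u * m powr (1 + \<epsilon>) + u * n powr (1 + \<epsilon>))"
    using assms(1) by (auto simp: h_def max_def)
  finally have 2: "(m * n) powr (\<epsilon> / 2) * (u * m + u * n) \<le> \<dots>" .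
  have "0 \<le> u powr (2 / (s + 1)) * (m * n) powr (s / (s + 1) + \<epsilon>)" by simp
  with 1 2 show ?thesis unfolding incidence_bound_def add.assoc distrib_left by linarith
qed

theorem theorem1p12:
  fixes \<epsilon> :: real
  assumes "\<epsilon> > 0"
  shows "\<exists>C::real. \<forall>(P1::'a::euclidean_space set) P2 (u::nat).
           finite P1 \<longrightarrow> finite P2 \<longrightarrow> diameter (P1 \<union> P2) = 1 \<longrightarrow> Kuu_free u P1 P2 \<longrightarrow>
           (let m = real (card P1); n = real (card P2); s = real ((DIM('a) + 1) div 2) in
             real (card (unit_dist_edges P1 P2))
               \<le> C * (real u powr (2 / (s + 1)) * (m * n) powr (s / (s + 1) + \<epsilon>)
                      + real u * m powr (1 + \<epsilon>) + real u * n powr (1 + \<epsilon>)))"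
proof -
  define s where "s = real ((DIM('a) + 1) div 2)"
  obtain C where "C \<ge> 0" and C: "\<And>(A::'a set) B u. finite A \<Longrightarrow> finite B \<Longrightarrow>
     \<forall>a\<in>A. \<forall>b\<in>B. dist a b \<le> 1 \<Longrightarrow> Kuu_free u A B \<Longrightarrow>
     real (card (unit_dist_edges A B)) \<le> C * incidence_bound s (\<epsilon> / 2) u (card A) (card B)"
    using unit_distance_bound[of "\<epsilon> / 2", where 'a='a] assms unfolding s_def by auto
  have "real (card (unit_dist_edges P1 P2)) \<le> 2 * C * (real u powr (2 / (s + 1)) * (real (card P1) * real (card P2)) powr (s / (s + 1) + \<epsilon>)
          + real u * real (card P1) powr (1 + \<epsilon>) + real u * real (card P2) powr (1 + \<epsilon>))"
    if P: "finite P1" "finite P2" "diameter (P1 \<union> P2) = 1" "Kuu_free u P1 P2" for P1 P2 :: "'a set" and u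
  proof (cases "P1 = {} \<or> P2 = {}")
    case True
    then have "unit_dist_edges P1 P2 = {}" by (auto simp: unit_dist_edges_def)
    then show ?thesis using \<open>C \<ge> 0\<close> by simp
  next
    case False
    then have card: "real (card P1) \<ge> 1" "real (card P2) \<ge> 1"
      using P by (simp_all add: Suc_leI card_gt_0_iff)
    have "bounded (P1 \<union> P2)" using P by (simp add: finite_imp_bounded)
    then have "\<forall>a\<in>P1. \<forall>b\<in>P2. dist a b \<le> 1" using diameter_bounded_bound P(3) by (metis UnCI)
    then have "real (card (unit_dist_edges P1 P2)) \<le> C * incidence_bound s (\<epsilon> / 2) u (card P1) (card P2)"
      using C P by blast
    also have "\<dots> \<le> C * (2 * (real u powr (2 / (s + 1)) * (real (card P1) * real (card P2)) powr (s / (s + 1) + \<epsilon>)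
          + real u * real (card P1) powr (1 + \<epsilon>) + real u * real (card P2) powr (1 + \<epsilon>)))"
      using \<open>C \<ge> 0\<close> card assms by (intro mult_left_mono incidence_bound_half_le) auto
    finally show ?thesis by (simp only: mult_ac)
  qed
  then show ?thesis unfolding Let_def s_def by blast
qed

end
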